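(* Let $N\in\mathbb{N}$, let $\boldsymbol{\nu}=(\nu_1,\dots,\nu_N)\in\overline{\mathbb{W}}_N$ (so $\nu_1\le\nu_2\le\dots\le\nu_N$, coincidences allowed), and let $\nu_N=\sum_{j=1}^N\delta_{\nu_j}$. Then $$\Big(\tfrac1t\circ\Xi(t),\ t\in(0,\infty),\ \mathbb{P}^{N\delta_0}_{\nu_N}\Big)\ \stackrel{\rm (law)}{=}\ \Big(\Xi\big(\tfrac1t\big),\ t\in(0,\infty),\ \mathbb{P}^{\nu_N}\Big),$$ that is, the dilatation by factor $1/t$ of the noncolliding Brownian motion with drift $\nu_N$ started with all $N$ particles at the origin, and the driftless noncolliding Brownian motion started from the configuration $\nu_N$ and observed at time $1/t$, have the same finite-dimensional distributions (at all finite sequences of times $0<t_1<\dots<t_M<\infty$, $M\in\mathbb{N}$).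
   Context: Notation. $\mathbb{W}_N=\{\boldsymbol{x}\in\mathbb{R}^N: x_1<\dots<x_N\}$, $\overline{\mathbb{W}}_N=\{\boldsymbol{x}\in\mathbb{R}^N: x_1\le\dots\le x_N\}$. $h_N(\boldsymbol{x})=\prod_{1\le j<k\le N}(x_k-x_j)$. $p(t,y|x)=\frac{1}{\sqrt{2\pi t}}e^{-(y-x)^2/2t}$ for $t>0$. $q_N(t,\boldsymbol{y}|\boldsymbol{x})=\det_{1\le j,k\le N}[p(t,y_j|x_k)]$. Transition densities. For $\boldsymbol{x},\boldsymbol{y},\boldsymbol{\nu}\in\mathbb{W}_N$, $t>0$, the noncolliding Brownian motion with drift $\boldsymbol{\nu}$ has transition density $$p_N^{\boldsymbol{\nu}}(t,\boldsymbol{y}|\boldsymbol{x})=e^{-t|\boldsymbol{\nu}|^2/2}\,\frac{\det_{1\le j,k\le N}[e^{\nu_jy_k}]}{\det_{1\le j,k\le N}[e^{\nu_jx_k}]}\,q_N(t,\boldsymbol{y}|\boldsymbol{x}),$$ extended to $\boldsymbol{x},\boldsymbol{\nu}\in\overline{\mathbb{W}}_N$ by taking limits from $\mathbb{W}_N$. The driftless noncolliding Brownian motion has transition density $p_N(t,\boldsymbol{y}|\boldsymbol{x})=\frac{h_N(\boldsymbol{y})}{h_N(\boldsymbol{x})}q_N(t,\boldsymbol{y}|\boldsymbol{x})$ for $\boldsymbol{x},\boldsymbol{y}\in\mathbb{W}_N$, extended to $\boldsymbol{x}\in\overline{\mathbb{W}}_N$ by limits (this is the case $\boldsymbol{\nu}=\boldsymbol{0}$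 of the former). Configurations and processes. A labeled configuration $\boldsymbol{x}\in\overline{\mathbb{W}}_N$ is identified with the unlabeled configuration $\xi=\sum_{j=1}^N\delta_{x_j}$ (a nonnegative integer-valued Radon measure on $\mathbb{R}$). For $c>0$, the dilatation is $c\circ\xi=\sum_j\delta_{cx_j}$. For $\xi_N=\sum_{j=1}^N\delta_{x_j}$ with $\boldsymbol{x}\in\overline{\mathbb{W}}_N$ and $\nu_N=\sum_{j=1}^N\delta_{\nu_j}$ with $\boldsymbol{\nu}\in\overline{\mathbb{W}}_N$, $\mathbb{P}^{\xi_N}_{\nu_N}$ is the law of the Markov process $\Xi(t)=\sum_{j=1}^N\delta_{X_j(t)}$ started from $\xi_N$ whose joint density at times $0<t_1<\dots<t_M$ at configurations $\boldsymbol{x}^{(1)},\dots,\boldsymbol{x}^{(M)}\in\mathbb{W}_N$ (with respect to Lebesgue measure $\prod_m d\boldsymbol{x}^{(m)}$ on $\mathbb{W}_N^M$) is $$p_N^{\boldsymbol{\nu}}(t_1,\boldsymbol{x}^{(1)}|\boldsymbol{x})\prod_{m=1}^{M-1}p_N^{\boldsymbol{\nu}}(t_{m+1}-t_m,\boldsymbol{x}^{(m+1)}|\boldsymbol{x}^{(m)}).$$ $\mathbb{P}^{\xi_N}$ is the law of the driftless process, defined in the same way with $p_N$ in place of $p_N^{\boldsymbol{\nu}}$. $N\delta_0$ is the configuration with all $N$ particles at the origin. Two processes with the same state space are called equivalent, written $\stackrel{\rm (law)}{=}$, if for every $M\in\mathbb{N}$ and all times $0<t_1<\dots<t_M<\infty$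 their multitime joint probability densities coincide. *)

theory Defs
  imports "HOL-Probability.Probability" "HOL-Library.Multiset"
begin

text \<open>
  The index set {1,...,N} is represented by an arbitrary finite linearly ordered type,
  so N = CARD('n) and vectors in N-space are elements of the type \<open>real ^ 'n\<close>.
\<close>

definition weyl :: "(real ^ 'n::{finite,linorder}) set" where
  "weyl = {x. \<forall>j k. j < k \<longrightarrow> x $ j < x $ k}"

definition weyl_closed :: "(real ^ 'n::{finite,linorder}) set" where
  "weyl_closed = {x. \<forall>j k. j < k \<longrightarrow> x $ j \<le> x $ k}"

definition vandermonde :: "real ^ 'n::{finite,linorder} \<Rightarrow> real" where
  "vandermonde x = (\<Prod>(j, k)\<in>{(j, k). j < k}. x $ k - x $ j)"

definition heat_kernel :: "real \<Rightarrow> real \<Rightarrow> real \<Rightarrow> real" where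
  "heat_kernel t y x = 1 / sqrt (2 * pi * t) * exp (- ((y - x)\<^sup>2) / (2 * t))"

definition karlin_mcgregor ::
    "real \<Rightarrow> real ^ 'n::{finite,linorder} \<Rightarrow> real ^ 'n::{finite,linorder} \<Rightarrow> real" where
  "karlin_mcgregor t y x = det (\<chi> j k. heat_kernel t (y $ j) (x $ k))"

definition drift_density_interior ::
    "real ^ 'n::{finite,linorder} \<Rightarrow> real \<Rightarrow> real ^ 'n::{finite,linorder} \<Rightarrow> real ^ 'n::{finite,linorder} \<Rightarrow> real" where
  "drift_density_interior \<nu> t y x =
     exp (- t * (norm \<nu>)\<^sup>2 / 2)
     * (det (\<chi> j k. exp (\<nu> $ j * y $ k)) / det (\<chi> j k. exp (\<nu> $ j * x $ k)))
     * karlin_mcgregor t y x"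

text \<open>The extension to coinciding starting points or drifts is the joint limit in both variables.\<close>

definition drift_density ::
    "real ^ 'n::{finite,linorder} \<Rightarrow> real \<Rightarrow> real ^ 'n::{finite,linorder} \<Rightarrow> real ^ 'n::{finite,linorder} \<Rightarrow> real" where
  "drift_density \<nu> t y x =
     (if x \<in> weyl \<and> \<nu> \<in> weyl then drift_density_interior \<nu> t y x
      else Lim (at (x, \<nu>) within weyl \<times> weyl)
             (\<lambda>(x', \<nu>'). drift_density_interior \<nu>' t y x'))"

definition driftless_density_interior ::
    "real \<Rightarrow> real ^ 'n::{finite,linorder} \<Rightarrow> real ^ 'n::{finite,linorder} \<Rightarrow> real" where
  "driftless_density_interior t y x =
     vandermonde y / vandermonde x * karlin_mcgregor t y x"

definition driftless_density ::
    "real \<Rightarrow> real ^ 'n::{finite,linorder} \<Rightarrow> real ^ 'n::{finite,linorder} \<Rightarrow> real" where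
  "driftless_density t y x =
     (if x \<in> weyl then driftless_density_interior t y x
      else Lim (at x within weyl) (\<lambda>x'. driftless_density_interior t y x'))"

text \<open>
  A finite sum of Dirac masses is encoded as the finite multiset of its atoms.
\<close>

definition configuration :: "real ^ 'n::{finite,linorder} \<Rightarrow> real multiset" where
  "configuration x = image_mset (\<lambda>j. x $ j) (mset_set UNIV)"

definition dilatation :: "real \<Rightarrow> real multiset \<Rightarrow> real multiset" where
  "dilatation c \<xi> = image_mset (\<lambda>a. c * a) \<xi>"

text \<open>
  The increasing labeling; it is uniquely determined for configurations of CARD('n) points.
\<close>

definition labeling :: "real multiset \<Rightarrow> real ^ 'n::{finite,linorder}" where
  "labeling \<xi> = (THE x. x \<in> weyl_closed \<and> configuration x = \<xi>)"

text \<open>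
  \<open>has_joint_density P X M t \<rho>\<close>: under P, the labeled configurations at times t 1, ..., t M
  have joint density \<open>\<rho>\<close> on the M-fold product of the open chamber with respect to Lebesgue
  measure.
\<close>

definition has_joint_density ::
    "'w measure \<Rightarrow> (real \<Rightarrow> 'w \<Rightarrow> real multiset) \<Rightarrow> nat \<Rightarrow> (nat \<Rightarrow> real)
     \<Rightarrow> ((nat \<Rightarrow> real ^ 'n::{finite,linorder}) \<Rightarrow> real) \<Rightarrow> bool" where
  "has_joint_density P X M t \<rho> \<longleftrightarrow>
     (\<forall>m\<in>{1..M}. \<forall>\<omega>\<in>space P. size (X (t m) \<omega>) = CARD('n)) \<and>
     distributed P (Pi\<^sub>M {1..M} (\<lambda>_. lborel))
       (\<lambda>\<omega>. \<lambda>m\<in>{1..M}. labeling (X (t m) \<omega>))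
       (\<lambda>xs. ennreal (\<rho> xs) * indicator (Pi\<^sub>E {1..M} (\<lambda>_. weyl)) xs)"

definition admissible_times :: "nat \<Rightarrow> (nat \<Rightarrow> real) \<Rightarrow> bool" where
  "admissible_times M t \<longleftrightarrow> 1 \<le> M \<and> 0 < t 1 \<and> strict_mono_on {1..M} t"

text \<open>Transition densities take their arguments in the order time, target, source.\<close>

definition multitime_density ::
    "(real \<Rightarrow> real ^ 'n::{finite,linorder} \<Rightarrow> real ^ 'n::{finite,linorder} \<Rightarrow> real) \<Rightarrow> real ^ 'n::{finite,linorder}
     \<Rightarrow> nat \<Rightarrow> (nat \<Rightarrow> real) \<Rightarrow> (nat \<Rightarrow> real ^ 'n::{finite,linorder}) \<Rightarrow> real" where
  "multitime_density p x M t xs =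
     p (t 1) (xs 1) x * (\<Prod>m\<in>{1..<M}. p (t (m + 1) - t m) (xs (m + 1)) (xs m))"

definition process_with_density ::
    "(real \<Rightarrow> real ^ 'n::{finite,linorder} \<Rightarrow> real ^ 'n::{finite,linorder} \<Rightarrow> real) \<Rightarrow> real ^ 'n::{finite,linorder}
     \<Rightarrow> 'w measure \<Rightarrow> (real \<Rightarrow> 'w \<Rightarrow> real multiset) \<Rightarrow> bool" where
  "process_with_density p x P X \<longleftrightarrow>
     prob_space P \<and>
     (AE \<omega> in P. X 0 \<omega> = configuration x) \<and>
     (\<forall>M t. admissible_times M t \<longrightarrow> has_joint_density P X M t (multitime_density p x M t))"

text \<open>
  The process X on the probability space P realizes the law of the noncolliding Brownian motion
  with drift \<open>\<nu>\<close>, respectively without drift, started from the configuration of x.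
\<close>

definition noncolliding_BM_drift ::
    "real ^ 'n::{finite,linorder} \<Rightarrow> real ^ 'n::{finite,linorder} \<Rightarrow> 'w measure
     \<Rightarrow> (real \<Rightarrow> 'w \<Rightarrow> real multiset) \<Rightarrow> bool" where
  "noncolliding_BM_drift \<nu> x P X \<longleftrightarrow> process_with_density (drift_density \<nu>) x P X"

definition noncolliding_BM ::
    "real ^ 'n::{finite,linorder} \<Rightarrow> 'w measure \<Rightarrow> (real \<Rightarrow> 'w \<Rightarrow> real multiset) \<Rightarrow> bool" where
  "noncolliding_BM x P X \<longleftrightarrow> process_with_density driftless_density x P X"

text \<open>
  Densities are determined only almost everywhere, so coincidence of the joint densities is
  expressed by a common joint density. The type argument fixes the number of particles.
\<close>

definition equal_in_law ::
    "'n::{finite,linorder} itself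
     \<Rightarrow> 'v measure \<Rightarrow> (real \<Rightarrow> 'v \<Rightarrow> real multiset)
     \<Rightarrow> 'w measure \<Rightarrow> (real \<Rightarrow> 'w \<Rightarrow> real multiset) \<Rightarrow> bool" where
  "equal_in_law (_ :: 'n itself) P X Q Y \<longleftrightarrow>
     (\<forall>M t. admissible_times M t \<longrightarrow>
        (\<exists>\<rho> :: (nat \<Rightarrow> real ^ 'n::{finite,linorder}) \<Rightarrow> real.
           has_joint_density P X M t \<rho> \<and> has_joint_density Q Y M t \<rho>))"

end

theory Submission
  imports Defs
begin

text \<open>
  Divided differences factor the matrix \<open>exp (a j * b k)\<close> as \<open>L(a) K(a, b) L(b)\<^sup>T\<close> with \<open>L\<close>
  triangular of determinant the Vandermonde product and \<open>K\<close> jointly continuous, so that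
  \<open>\<Phi> = det K\<close> extends \<open>det (exp (a j * b k)) / (h a * h b)\<close> to coinciding arguments. Since
  exponential polynomials of order N have fewer than N real zeros, \<open>\<Phi> \<nu> x\<close> does not vanish for
  \<open>x\<close> in the open chamber. Hence the limits defining both densities exist and are explicit in \<open>\<Phi>\<close>.

  The one-time densities of the two processes coincide; call the common value \<open>V t y\<close>. Brownian
  time inversion of the Karlin-McGregor determinant yields the detailed balance relation
  \<open>V s x * drift step (s x \<rightarrow> t y) = V t y * driftless step (y \<rightarrow> x)\<close> up to Jacobians, which moves
  \<open>V\<close> along the chain from the first time to the last and reverses every step.
\<close>

subsection \<open>Divided differences of exponentials\<close>


text \<open>The divided difference of the monomial \<open>z ^ n\<close> at the nodes \<open>a 0, ..., a m\<close>.\<close>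

fun divdiff_power :: "(nat \<Rightarrow> real) \<Rightarrow> nat \<Rightarrow> nat \<Rightarrow> real" where
  "divdiff_power a m 0 = (if m = 0 then 1 else 0)"
| "divdiff_power a m (Suc n) =
     a m * divdiff_power a m n + (if m = 0 then 0 else divdiff_power a (m - 1) n)"

definition newton_basis :: "(nat \<Rightarrow> real) \<Rightarrow> nat \<Rightarrow> real \<Rightarrow> real" where
  "newton_basis a m z = (\<Prod>l<m. z - a l)"

text \<open>The divided difference of \<open>exp (z * w)\<close> in \<open>z\<close> at
  \<open>a 0, ..., a m\<close>, taken term by term in the exponential series so that coinciding
  nodes need no separate treatment.\<close>

definition divdiff_exp :: "(nat \<Rightarrow> real) \<Rightarrow> nat \<Rightarrow> real \<Rightarrow> real" where
  "divdiff_exp a m w = (\<Sum>n. divdiff_power a m n / fact n * w ^ n)"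

text \<open>The divided difference of \<open>exp (z * w)\<close> at \<open>a 0, ..., a i\<close> in \<open>z\<close> and
  \<open>b 0, ..., b j\<close> in \<open>w\<close>.\<close>

definition divdiff_exp2 :: "(nat \<Rightarrow> real) \<Rightarrow> (nat \<Rightarrow> real) \<Rightarrow> nat \<Rightarrow> nat \<Rightarrow> real" where
  "divdiff_exp2 a b i j = (\<Sum>n. divdiff_power a i n * divdiff_power b j n / fact n)"

lemma newton_basis_Suc: "newton_basis a (Suc m) z = newton_basis a m z * (z - a m)"
  by (simp add: newton_basis_def mult.commute)

lemma newton_basis_eq_0: "j < m \<Longrightarrow> newton_basis a m (a j) = 0"
  by (auto simp: newton_basis_def)

lemma divdiff_power_eq_0: "n < m \<Longrightarrow> divdiff_power a m n = 0"
  by (induction n arbitrary: m) auto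

lemma divdiff_power_diag: "divdiff_power a n n = 1"
  by (induction n) (auto simp: divdiff_power_eq_0)

lemma divdiff_power_0: "divdiff_power (\<lambda>_. 0) m n = (if m = n then 1 else 0)"
  by (induction n arbitrary: m) auto

text \<open>Newton interpolation of the monomial: the hypothesis makes \<open>z\<close> one of the
  nodes, so there is no remainder. The induction rests on
  \<open>z * b m = a m * b m + b (m + 1)\<close> for the basis polynomials \<open>b\<close>.\<close>

lemma power_newton_expansion:
  assumes "newton_basis a N z = 0"
  shows "z ^ n = (\<Sum>m<N. newton_basis a m z * divdiff_power a m n)"
proof (induction n)
  case 0
  have "N > 0" using assms by (cases N) (auto simp: newton_basis_def)
  then have "(\<Sum>m<N. newton_basis a m z * divdiff_power a m 0) = newton_basis a 0 z"
    by (simp add: if_distrib cong: if_cong)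
  then show ?case by (simp add: newton_basis_def)
next
  case (Suc n)
  let ?b = "\<lambda>m. newton_basis a m z" and ?H = "divdiff_power a"
  \<comment> \<open>The index moves up by one: the new top term is
    \<open>newton_basis a N z = 0\<close>, and the missing term at 0 is filled in by zero.\<close>
  have shift: "(\<Sum>m<N. ?b (Suc m) * ?H m n) = (\<Sum>m<N. if m = 0 then 0 else ?b m * ?H (m - 1) n)"
  proof (cases N)
    case (Suc k)
    have "(\<Sum>m<N. ?b (Suc m) * ?H m n) = (\<Sum>m<k. ?b (Suc m) * ?H m n)"
      using assms Suc by simp
    then show ?thesis by (simp only: Suc sum.lessThan_Suc_shift) simp
  qed simp
  have "z ^ Suc n = (\<Sum>m<N. z * (?b m * ?H m n))"
    using Suc by (simp add: sum_distrib_left)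
  also have "\<dots> = (\<Sum>m<N. ?b m * (a m * ?H m n)) + (\<Sum>m<N. ?b (Suc m) * ?H m n)"
    by (simp add: newton_basis_Suc sum.distrib[symmetric] algebra_simps)
  also have "\<dots> = (\<Sum>m<N. ?b m * ?H m (Suc n))"
    unfolding shift sum.distrib[symmetric] by (intro sum.cong) (auto simp: algebra_simps)
  finally show ?case .
qed

text \<open>\<open>divdiff_power a m n\<close> is the complete homogeneous symmetric polynomial of
  degree \<open>n - m\<close> in \<open>a 0, ..., a m\<close>. The defining recursion splits off the
  last node; by symmetry the first node can be split off as well, which is what differentiation
  requires.\<close>

lemma divdiff_power_Suc_shift:
  "divdiff_power a (Suc m) (Suc n) =
     a 0 * divdiff_power a (Suc m) n + divdiff_power (\<lambda>i. a (Suc i)) m n"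
proof (induction n arbitrary: m)
  case (Suc n)
  have "divdiff_power a m (Suc n) =
      a 0 * divdiff_power a m n + (if m = 0 then 0 else divdiff_power (\<lambda>i. a (Suc i)) (m - 1) n)"
    using Suc by (cases m) (auto simp del: divdiff_power.simps(2), simp)
  then have "divdiff_power a (Suc m) (Suc (Suc n)) =
      a (Suc m) * (a 0 * divdiff_power a (Suc m) n + divdiff_power (\<lambda>i. a (Suc i)) m n) +
      (a 0 * divdiff_power a m n + (if m = 0 then 0 else divdiff_power (\<lambda>i. a (Suc i)) (m - 1) n))"
    by (subst divdiff_power.simps(2)) (simp only: Suc nat.simps if_False diff_Suc_1)
  then show ?case by (simp add: algebra_simps)
qed auto

section \<open>Bounds and convergence of the series\<close>

lemma abs_divdiff_power_le:
  assumes "\<And>i. i \<le> m \<Longrightarrow> \<bar>a i\<bar> \<le> R"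
  shows "\<bar>divdiff_power a m n\<bar> \<le> (R + 1) ^ n"
  using assms
proof (induction n arbitrary: m)
  case (Suc n)
  have R: "0 \<le> R" using Suc.prems[of 0] by simp
  have "\<bar>a m * divdiff_power a m n\<bar> \<le> R * (R + 1) ^ n"
    unfolding abs_mult using Suc.IH[of m] Suc.prems[of m] Suc.prems R by (intro mult_mono) auto
  moreover have "\<bar>if m = 0 then 0 else divdiff_power a (m - 1) n\<bar> \<le> (R + 1) ^ n"
    using Suc.IH[of "m - 1"] Suc.prems R by auto
  \<comment> \<open>The two summands of the recursion add up to
    \<open>R * (R + 1) ^ n + (R + 1) ^ n = (R + 1) ^ Suc n\<close>.\<close>
  ultimately show ?case by (simp add: algebra_simps)
qed auto

lemma bounded_nodes: "\<exists>R. \<forall>i\<le>m :: nat. \<bar>a i :: real\<bar> \<le> R"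
  by (intro exI[of _ "Max ((\<lambda>i. \<bar>a i\<bar>) ` {..m})"] allI impI Max_ge) auto

text \<open>The majorant depends on the nodes only through their bounds, so it gives summability
  here and uniform convergence on bounded sets later.\<close>

lemma norm_divdiff_exp2_term_le:
  assumes "\<And>i. i \<le> k \<Longrightarrow> \<bar>a i\<bar> \<le> R" "\<And>i. i \<le> l \<Longrightarrow> \<bar>b i\<bar> \<le> S"
  shows "norm (divdiff_power a k n * divdiff_power b l n / fact n)
           \<le> ((R + 1) * (S + 1)) ^ n / fact n"
proof -
  have "0 \<le> R" "0 \<le> S" using assms(1)[of 0] assms(2)[of 0] by auto
  moreover have "norm (divdiff_power a k n * divdiff_power b l n / fact n) =
      \<bar>divdiff_power a k n\<bar> * \<bar>divdiff_power b l n\<bar> / fact n"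
    by (simp add: abs_mult)
  ultimately show ?thesis
    unfolding power_mult_distrib by (simp only:, intro divide_right_mono mult_mono abs_divdiff_power_le assms) auto
qed

lemma summable_power_over_fact: "summable (\<lambda>n. (x :: real) ^ n / fact n)"
  using summable_exp[of x] by (simp add: field_simps)

lemma summable_divdiff_exp2:
  "summable (\<lambda>n. divdiff_power a i n * divdiff_power b j n / fact n)"
proof -
  obtain R where "\<forall>k\<le>i. \<bar>a k\<bar> \<le> R" using bounded_nodes by metis
  moreover obtain S where "\<forall>k\<le>j. \<bar>b k\<bar> \<le> S" using bounded_nodes by metis
  ultimately show ?thesis
    using norm_divdiff_exp2_term_le[of i a R j b S]
    by (intro summable_comparison_test[OF _ summable_power_over_fact[of "(R + 1) * (S + 1)"]]) auto
qed

lemma summable_divdiff_exp: "summable (\<lambda>n. divdiff_power a m n / fact n * w ^ n)"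
proof -
  \<comment> \<open>A divided difference at a single node is evaluation, so this series is an
    instance of the doubly divided one.\<close>
  have "divdiff_power (\<lambda>_. w) 0 n = w ^ n" for n by (induction n) auto
  then show ?thesis using summable_divdiff_exp2[of a m "\<lambda>_. w" 0] by simp
qed

text \<open>Each monomial of the series is Newton expanded at the nodes \<open>b\<close>, and the
  finite sum is interchanged with the series.\<close>

lemma divdiff_exp_newton_expansion:
  assumes "newton_basis b N w = 0"
  shows "divdiff_exp a i w = (\<Sum>j<N. divdiff_exp2 a b i j * newton_basis b j w)"
proof -
  have "divdiff_exp a i w =
    (\<Sum>n. \<Sum>j<N. divdiff_power a i n * divdiff_power b j n / fact n * newton_basis b j w)"
    unfolding divdiff_exp_def power_newton_expansion[OF assms]
    by (simp add: sum_distrib_left mult_ac)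
  also have "\<dots> = (\<Sum>j<N. \<Sum>n. divdiff_power a i n * divdiff_power b j n / fact n * newton_basis b j w)"
    by (intro suminf_sum summable_mult2 summable_divdiff_exp2)
  also have "\<dots> = (\<Sum>j<N. divdiff_exp2 a b i j * newton_basis b j w)"
    unfolding divdiff_exp2_def by (simp only: suminf_mult2[OF summable_divdiff_exp2])
  finally show ?thesis .
qed

lemma exp_newton_expansion:
  assumes "newton_basis a N z = 0"
  shows "exp (z * w) = (\<Sum>i<N. newton_basis a i z * divdiff_exp a i w)"
proof -
  have "exp (z * w) = (\<Sum>n. \<Sum>i<N. newton_basis a i z * (divdiff_power a i n / fact n * w ^ n))"
    unfolding exp_def power_mult_distrib power_newton_expansion[OF assms]
    by (simp add: sum_distrib_left sum_distrib_right mult_ac divide_inverse)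
  also have "\<dots> = (\<Sum>i<N. \<Sum>n. newton_basis a i z * (divdiff_power a i n / fact n * w ^ n))"
    by (intro suminf_sum summable_mult summable_divdiff_exp)
  also have "\<dots> = (\<Sum>i<N. newton_basis a i z * divdiff_exp a i w)"
    unfolding divdiff_exp_def by (simp only: suminf_mult[OF summable_divdiff_exp])
  finally show ?thesis .
qed

section \<open>Differential recursion and zeros\<close>

lemma DERIV_divdiff_exp:
  "(divdiff_exp a m has_real_derivative (\<Sum>n. divdiff_power a m (Suc n) / fact n * w ^ n)) (at w)"
proof -
  have "diffs (\<lambda>n. divdiff_power a m n / fact n) = (\<lambda>n. divdiff_power a m (Suc n) / fact n)"
    unfolding diffs_def by (rule ext) (simp del: divdiff_power.simps of_nat_Suc)
  moreover have "((\<lambda>w. \<Sum>n. divdiff_power a m n / fact n * w ^ n) has_real_derivative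
      (\<Sum>n. diffs (\<lambda>n. divdiff_power a m n / fact n) n * w ^ n)) (at w)"
    by (rule termdiffs_strong_converges_everywhere[OF summable_divdiff_exp])
  ultimately show ?thesis by (simp add: divdiff_exp_def[abs_def])
qed

lemma DERIV_divdiff_exp_0:
  "(divdiff_exp a 0 has_real_derivative a 0 * divdiff_exp a 0 w) (at w)"
proof -
  have "(\<Sum>n. divdiff_power a 0 (Suc n) / fact n * w ^ n) = a 0 * divdiff_exp a 0 w"
    unfolding divdiff_exp_def by (subst suminf_mult[OF summable_divdiff_exp, symmetric]) (simp add: mult_ac)
  then show ?thesis using DERIV_divdiff_exp[of a 0 w] by simp
qed

text \<open>Differentiation shifts the coefficients by one, and
  \<open>divdiff_power_Suc_shift\<close> splits the shifted coefficients at the first node.\<close>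

lemma DERIV_divdiff_exp_Suc:
  "(divdiff_exp a (Suc m) has_real_derivative
      a 0 * divdiff_exp a (Suc m) w + divdiff_exp (\<lambda>i. a (Suc i)) m w) (at w)"
proof -
  have "(\<Sum>n. divdiff_power a (Suc m) (Suc n) / fact n * w ^ n) =
     (\<Sum>n. a 0 * (divdiff_power a (Suc m) n / fact n * w ^ n)
        + divdiff_power (\<lambda>i. a (Suc i)) m n / fact n * w ^ n)"
    by (simp only: divdiff_power_Suc_shift) (simp add: algebra_simps add_divide_distrib)
  also have "\<dots> = a 0 * divdiff_exp a (Suc m) w + divdiff_exp (\<lambda>i. a (Suc i)) m w"
    unfolding divdiff_exp_def
    by (simp only: suminf_add[OF summable_mult, OF summable_divdiff_exp summable_divdiff_exp, symmetric]
        suminf_mult[OF summable_divdiff_exp])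
  finally show ?thesis using DERIV_divdiff_exp[of a "Suc m" w] by simp
qed

text \<open>Applying \<open>D - a 0\<close>, which Rolle's theorem lets cost only one zero, removes the node \<open>a 0\<close>.\<close>

lemma divdiff_exp_chebyshev:
  assumes "\<And>i j. i < j \<Longrightarrow> j < N \<Longrightarrow> x i < x j"
    and "\<And>k. k < N \<Longrightarrow> (\<Sum>m<N. c m * divdiff_exp a m (x k)) = 0"
    and "m < N"
  shows "c m = 0"
  using assms
proof (induction N arbitrary: a c x m)
  case (Suc N)
  define a' where "a' = (\<lambda>i. a (Suc i))"
  define f where "f = (\<lambda>w. \<Sum>m<Suc N. c m * divdiff_exp a m w)"
  define g where "g = (\<lambda>w. \<Sum>m<N. c (Suc m) * divdiff_exp a' m w)"
  have f_eq: "f = (\<lambda>w. c 0 * divdiff_exp a 0 w + (\<Sum>m<N. c (Suc m) * divdiff_exp a (Suc m) w))"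
    unfolding f_def by (simp only: sum.lessThan_Suc_shift)
  have df: "(f has_real_derivative a 0 * f w + g w) (at w)" for w
  proof -
    have "(f has_real_derivative c 0 * (a 0 * divdiff_exp a 0 w) +
        (\<Sum>m<N. c (Suc m) * (a 0 * divdiff_exp a (Suc m) w + divdiff_exp a' m w))) (at w)"
      unfolding f_eq a'_def
      by (intro DERIV_add DERIV_cmult DERIV_sum DERIV_divdiff_exp_0 DERIV_divdiff_exp_Suc)
    also have "c 0 * (a 0 * divdiff_exp a 0 w) +
        (\<Sum>m<N. c (Suc m) * (a 0 * divdiff_exp a (Suc m) w + divdiff_exp a' m w)) = a 0 * f w + g w"
      unfolding f_eq g_def by (simp add: algebra_simps sum.distrib sum_distrib_left)
    finally show ?thesis .
  qed
  \<comment> \<open>The factor \<open>exp (- a 0 * w)\<close> keeps the zeros of \<open>f\<close>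
    and turns \<open>f' - a 0 * f = g\<close> into the derivative of \<open>h\<close>, so Rolle's
    theorem for \<open>h\<close> yields zeros of \<open>g\<close>.\<close>
  define h where "h = (\<lambda>w. exp (- a 0 * w) * f w)"
  have dh: "(h has_real_derivative exp (- a 0 * w) * g w) (at w)" for w
    unfolding h_def by (rule derivative_eq_intros df refl)+ (simp add: algebra_simps)
  have hx: "h (x k) = 0" if "k < Suc N" for k
    using Suc.prems(2)[OF that] by (simp add: h_def f_def)
  have "\<exists>z. x k < z \<and> z < x (Suc k) \<and> g z = 0" if k: "k < N" for k
  proof -
    have lt: "x k < x (Suc k)" using Suc.prems(1) k by simp
    have "continuous_on {x k..x (Suc k)} h"
      by (intro DERIV_continuous_on) (rule DERIV_subset[OF dh subset_UNIV])
    then have "\<exists>z. x k < z \<and> z < x (Suc k) \<and> DERIV h z :> 0"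
      using Rolle[OF lt, of h] hx[of k] hx[of "Suc k"] k dh real_differentiable_def by auto
    then obtain z where z: "x k < z" "z < x (Suc k)" "DERIV h z :> 0" by blast
    have "exp (- a 0 * z) * g z = 0" using DERIV_unique[OF z(3) dh] by simp
    then show ?thesis using z by auto
  qed
  then obtain z where z: "\<And>k. k < N \<Longrightarrow> x k < z k \<and> z k < x (Suc k) \<and> g (z k) = 0" by metis
  \<comment> \<open>The new zeros lie in successive gaps between the old ones and are therefore
    strictly increasing.\<close>
  have zmono: "z i < z j" if "i < j" "j < N" for i j
  proof -
    have "x (Suc i) \<le> x j" using Suc.prems(1)[of "Suc i" j] that by (cases "Suc i = j") auto
    then show ?thesis using z[of i] z[of j] that by auto
  qed
  have cS: "c (Suc i) = 0" if "i < N" for i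
    using Suc.IH[of z "\<lambda>m. c (Suc m)" a' i] zmono z that unfolding g_def by auto
  have "c 0 * divdiff_exp a 0 (x 0) = 0"
    using Suc.prems(2)[of 0] cS by (simp only: sum.lessThan_Suc_shift) simp
  \<comment> \<open>Only the coefficient of the pure exponential \<open>exp (a 0 * w)\<close> is
    left, and this function has no zero.\<close>
  moreover have "divdiff_exp a 0 (x 0) \<noteq> 0"
  proof -
    have "divdiff_power a 0 n = a 0 ^ n" for n by (induction n) auto
    then have "divdiff_exp a 0 (x 0) = exp (a 0 * x 0)"
      by (simp add: divdiff_exp_def exp_def power_mult_distrib divide_inverse mult_ac)
    then show ?thesis by simp
  qed
  ultimately have "c 0 = 0" by simp
  then show ?case using cS Suc.prems(3) by (cases m) auto
qed simp


subsection \<open>Determinants of exponentials\<close>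

text \<open>The rank counted from 0 carries the abstract index type to the natural numbers, where
  the nodes of divided differences are indexed.\<close>

definition position :: "'n::{finite,linorder} \<Rightarrow> nat" where
  "position j = card {..<j}"

lemma position_less_iff [simp]: "position i < position j \<longleftrightarrow> i < j"
proof -
  have mono: "position i < position j" if "i < j" for i j :: 'a
    unfolding position_def using that by (intro psubset_card_mono) auto
  show ?thesis using mono[of i j] mono[of j i] by (cases i j rule: linorder_cases) auto
qed

lemma inj_position: "inj position"
  by (rule linorder_injI) (metis position_less_iff less_irrefl)

lemma position_less_CARD: "position (j :: 'n::{finite,linorder}) < CARD('n)"
  unfolding position_def by (intro psubset_card_mono) auto

lemma bij_betw_position:
  "bij_betw position (UNIV :: 'n::{finite,linorder} set) {..<CARD('n)}"
proof -
  have "range (position :: 'n \<Rightarrow> nat) \<subseteq> {..<CARD('n)}" by (auto simp: position_less_CARD)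
  moreover have "card (range (position :: 'n \<Rightarrow> nat)) = card {..<CARD('n)}"
    by (simp add: card_image inj_position)
  ultimately have "range (position :: 'n \<Rightarrow> nat) = {..<CARD('n)}"
    by (intro card_subset_eq) auto
  then show ?thesis using inj_position by (simp add: bij_betw_def)
qed

lemma ex_position: "i < CARD('n) \<Longrightarrow> \<exists>j :: 'n::{finite,linorder}. i = position j"
  using bij_betw_imp_surj_on[OF bij_betw_position[where 'n='n]] by auto

lemma bij_betw_position_lessThan:
  "bij_betw position {..<j :: 'n::{finite,linorder}} {..<position j}"
proof -
  have "position ` {..<j} \<subseteq> {..<position j}" by auto
  moreover have "card (position ` {..<j}) = card {..<position j}"
    by (subst card_image) (auto simp: position_def[of j] intro: inj_on_subset[OF inj_position])
  ultimately have "position ` {..<j} = {..<position j}" by (intro card_subset_eq) auto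
  then show ?thesis using inj_position by (auto simp: bij_betw_def intro: inj_on_subset)
qed

text \<open>At indices from \<open>CARD('n)\<close> on, the inverse picks some fixed coordinate;
  bounds and continuity thus hold at every natural index.\<close>

definition entries :: "real ^ 'n::{finite,linorder} \<Rightarrow> nat \<Rightarrow> real" where
  "entries x i = x $ inv position i"

lemma entries_position [simp]: "entries x (position j) = x $ j"
  by (simp add: entries_def inv_f_f inj_position)

text \<open>Every permutation other than the identity moves some index up, where it meets a zero
  entry.\<close>

lemma det_lower_triangular:
  fixes A :: "real ^ 'n::{finite,linorder} ^ 'n::{finite,linorder}"
  assumes "\<And>i j. i < j \<Longrightarrow> A $ i $ j = 0"
  shows "det A = (\<Prod>i\<in>UNIV. A $ i $ i)"
proof -
  have zero: "(\<Prod>i\<in>UNIV. A $ i $ p i) = 0" if p: "p permutes UNIV" "p \<noteq> id" for p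
  proof -
    have "\<exists>i. i < p i"
    proof (rule ccontr)
      assume "\<nexists>i. i < p i"
      then have le: "position (p i) \<le> position i" for i
        using position_less_iff[of i "p i"] by (meson not_le)
      \<comment> \<open>A permutation preserves the sum of the ranks, so a pointwise inequality
        between the ranks must be an equality.\<close>
      have "(\<Sum>i\<in>UNIV. position (p i)) = (\<Sum>i\<in>(UNIV :: 'n set). position i)"
        by (rule sum.reindex_bij_betw[OF permutes_imp_bij[OF p(1)]])
      then have "position (p i) = position i" for i
        using le sum_mono_inv[of "\<lambda>i. position (p i)" UNIV position i] by auto
      then have "p = id" by (intro ext) (auto intro: injD[OF inj_position])
      with p show False by simp
    qed
    then show ?thesis using assms by (intro prod_zero) auto
  qed
  have "det A = (\<Sum>p\<in>{id}. of_int (sign p) * (\<Prod>i\<in>UNIV. A $ i $ p i))"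
    unfolding det_def
    by (rule sum.mono_neutral_right) (auto simp: permutes_id zero finite_permutations)
  then show ?thesis by simp
qed

text \<open>Serves to strip Gaussian factors that depend on the row or on the column alone.\<close>

lemma det_scale_rows_columns:
  fixes A :: "real ^ 'n::finite ^ 'n::finite"
  shows "det (\<chi> i j. u i * A $ i $ j * v j) = (\<Prod>i\<in>UNIV. u i) * det A * (\<Prod>j\<in>UNIV. v j)"
proof -
  have "det (\<chi> i j. u i * A $ i $ j * v j) = (\<Prod>i\<in>UNIV. u i) * det (\<chi> i j. A $ i $ j * v j)"
    using det_rows_mul[of u "\<lambda>i. \<chi> j. A $ i $ j * v j"]
    by (simp add: vector_scalar_mult_def mult.assoc)
  also have "det (\<chi> i j. A $ i $ j * v j) = det (transpose (\<chi> i j. A $ i $ j * v j))"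
    by (rule det_transpose[symmetric])
  also have "\<dots> = (\<Prod>j\<in>UNIV. v j) * det (transpose A)"
    using det_rows_mul[of v "\<lambda>j. \<chi> i. A $ i $ j"]
    by (simp add: vector_scalar_mult_def transpose_def mult.commute)
  finally show ?thesis by simp
qed

definition newton_matrix :: "real ^ 'n::{finite,linorder} \<Rightarrow> real ^ 'n::{finite,linorder} ^ 'n::{finite,linorder}" where
  "newton_matrix x = (\<chi> j l. newton_basis (entries x) (position l) (x $ j))"

lemma newton_basis_entries:
  "newton_basis (entries x) (position l) z = (\<Prod>p<l. z - x $ p)"
proof -
  have "(\<Prod>p<l. z - entries x (position p)) = newton_basis (entries x) (position l) z"
    unfolding newton_basis_def by (rule prod.reindex_bij_betw[OF bij_betw_position_lessThan])
  then show ?thesis by simp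
qed

lemma newton_basis_CARD:
  fixes x :: "real ^ 'n::{finite,linorder}"
  shows "newton_basis (entries x) CARD('n) (x $ j) = 0"
  using newton_basis_eq_0[OF position_less_CARD, of "entries x" j] by simp

text \<open>Above the diagonal the product in row \<open>j\<close> contains the factor
  \<open>x $ j - x $ j\<close>, so the matrix is lower triangular and its diagonal collects the
  Vandermonde factors.\<close>

lemma det_newton_matrix: "det (newton_matrix x) = vandermonde x"
proof -
  have "det (newton_matrix x) = (\<Prod>k\<in>UNIV. \<Prod>j<k. x $ k - x $ j)"
    by (subst det_lower_triangular) (auto simp: newton_matrix_def newton_basis_entries)
  also have "\<dots> = (\<Prod>(k, j)\<in>Sigma UNIV lessThan. x $ k - x $ j)"
    by (rule prod.Sigma) auto
  also have "\<dots> = vandermonde x"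
    unfolding vandermonde_def
    by (rule prod.reindex_bij_witness[where i=prod.swap and j=prod.swap]) auto
  finally show ?thesis .
qed

text \<open>The continuous extension of \<open>det (exp (a j * b k)) / (h a * h b)\<close> to all \<open>a\<close> and
  \<open>b\<close>; this is the Harish-Chandra-Itzykson-Zuber integral up to a constant.\<close>

definition hciz :: "real ^ 'n::{finite,linorder} \<Rightarrow> real ^ 'n::{finite,linorder} \<Rightarrow> real" where
  "hciz a b = det (\<chi> i j :: 'n. divdiff_exp2 (entries a) (entries b) (position i) (position j))"

lemma sum_position:
  "(\<Sum>j\<in>(UNIV :: 'n::{finite,linorder} set). f (position j)) = (\<Sum>i<CARD('n). f i)"
  by (rule sum.reindex_bij_betw[OF bij_betw_position])

text \<open>Newton expansion in the second variable alone is a matrix product. Keeping the first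
  variable in divided form lets \<open>a\<close> have coincidences in the proof that
  \<open>hciz a b\<close> is nonzero.\<close>

lemma det_divdiff_exp:
  fixes b :: "real ^ 'n::{finite,linorder}"
  shows "det (\<chi> i k. divdiff_exp (entries a) (position i) (b $ k)) = hciz a b * vandermonde b"
proof -
  have D: "((\<chi> i k. divdiff_exp (entries a) (position i) (b $ k)) :: real ^ 'n::{finite,linorder} ^ 'n::{finite,linorder}) =
    (\<chi> i j. divdiff_exp2 (entries a) (entries b) (position i) (position j))
      ** transpose (newton_matrix b)"
    by (simp add: vec_eq_iff matrix_matrix_mult_def transpose_def newton_matrix_def
        divdiff_exp_newton_expansion[OF newton_basis_CARD] sum_position[symmetric])
  show ?thesis unfolding D by (simp add: det_mul det_newton_matrix hciz_def)
qed

lemma det_exp_eq_hciz: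
  "det (\<chi> j k. exp (a $ j * b $ k)) = vandermonde a * hciz a b * vandermonde b"
proof -
  have "(\<chi> j k. exp (a $ j * b $ k)) =
    newton_matrix a ** (\<chi> i k. divdiff_exp (entries a) (position i) (b $ k))"
    by (simp add: vec_eq_iff matrix_matrix_mult_def newton_matrix_def
        exp_newton_expansion[OF newton_basis_CARD] sum_position[symmetric])
  then show ?thesis by (simp add: det_mul det_newton_matrix det_divdiff_exp)
qed

lemma hciz_commute: "hciz a b = hciz b a"
  unfolding hciz_def
  by (subst det_transpose[symmetric]) (simp add: transpose_def divdiff_exp2_def mult.commute)

text \<open>With all nodes at 0 the divided difference of order \<open>i\<close> extracts the Taylor
  coefficient of order \<open>i\<close>. The matrix becomes triangular with diagonal
  \<open>1 / fact i\<close>, whatever \<open>b\<close> is.\<close>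

lemma hciz_0_left: "hciz (0 :: real ^ 'n::{finite,linorder}) b = (\<Prod>i\<in>(UNIV :: 'n set). 1 / fact (position i))"
proof -
  have 0: "entries (0 :: real ^ 'n::{finite,linorder}) = (\<lambda>_. 0)" by (simp add: entries_def fun_eq_iff)
  have eq: "divdiff_exp2 (\<lambda>_. 0) (entries b) i j = divdiff_power (entries b) j i / fact i" for i j
  proof -
    have "divdiff_exp2 (\<lambda>_. 0) (entries b) i j =
        (\<Sum>n\<in>{i}. (if i = n then 1 else 0) * divdiff_power (entries b) j n / fact n)"
      unfolding divdiff_exp2_def divdiff_power_0 by (rule suminf_finite) auto
    then show ?thesis by simp
  qed
  show ?thesis
    unfolding hciz_def 0 eq
    by (subst det_lower_triangular) (auto simp: divdiff_power_eq_0 divdiff_power_diag)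
qed

lemma hciz_0_nonzero: "hciz 0 b \<noteq> 0"
  by (simp add: hciz_0_left)

lemma vandermonde_pos: "x \<in> weyl \<Longrightarrow> vandermonde x > 0"
  unfolding vandermonde_def by (intro prod_pos) (auto simp: weyl_def)

text \<open>If the determinant vanished, a kernel vector would give a nontrivial combination of the
  N functions \<open>divdiff_exp a m\<close> with zeros at the N distinct coordinates of
  \<open>b\<close>, against \<open>divdiff_exp_chebyshev\<close>.\<close>

lemma hciz_nonzero:
  fixes b :: "real ^ 'n::{finite,linorder}"
  assumes "b \<in> weyl"
  shows "hciz a b \<noteq> 0"
proof
  assume "hciz a b = 0"
  \<comment> \<open>Transposed, so that a kernel vector lists the coefficients of the
    functions.\<close>
  define E :: "real ^ 'n::{finite,linorder} ^ 'n::{finite,linorder}" where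
    "E = transpose (\<chi> i k. divdiff_exp (entries a) (position i) (b $ k))"
  have "det E = 0" using \<open>hciz a b = 0\<close> by (simp add: E_def det_divdiff_exp)
  then have "\<not> (\<exists>F. F ** E = mat 1)"
    using invertible_det_nz[of E] by (simp add: invertible_left_inverse)
  then obtain c where c: "E *v c = 0" "c \<noteq> 0"
    unfolding matrix_left_invertible_ker by blast
  have "c $ j = 0" for j
  proof -
    have "entries c (position j) = 0"
    proof (rule divdiff_exp_chebyshev)
      show "entries b i < entries b j" if ij: "i < j" "j < CARD('n)" for i j
      proof -
        obtain i' j' :: 'n where "i = position i'" "j = position j'"
          using ij ex_position[where 'n='n, of i] ex_position[where 'n='n, of j] by auto
        then show ?thesis using ij assms by (auto simp: weyl_def)
      qed
      show "(\<Sum>m<CARD('n). entries c m * divdiff_exp (entries a) m (entries b k)) = 0"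
        if k_less: "k < CARD('n)" for k
      proof -
        obtain k' :: 'n where k: "k = position k'"
          using ex_position[where 'n='n, OF k_less] by auto
        have "(E *v c) $ k' = 0" by (simp add: c)
        then show ?thesis
          by (simp add: E_def k matrix_vector_mult_def transpose_def mult.commute flip: sum_position)
      qed
      show "position j < CARD('n)" by (rule position_less_CARD)
    qed
    then show ?thesis by simp
  qed
  with c(2) show False by (simp add: vec_eq_iff)
qed

section \<open>Joint continuity of \<open>hciz\<close>\<close>

lemma continuous_on_divdiff_power:
  assumes "\<And>i. continuous_on S (\<lambda>x. f x i)"
  shows "continuous_on S (\<lambda>x. divdiff_power (f x) m n)"
proof (induction n arbitrary: m)
  case (Suc n)
  then show ?case
    by (cases "m = 0") (simp_all add: continuous_on_add continuous_on_mult assms)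
qed auto

text \<open>Each term is a polynomial in the nodes, and the series converges uniformly on products
  of balls by the Weierstrass test; every point is interior to such a product.\<close>

lemma continuous_on_divdiff_exp2:
  "continuous_on UNIV (\<lambda>p :: (real ^ 'n::{finite,linorder}) \<times> (real ^ 'n::{finite,linorder}).
     divdiff_exp2 (entries (fst p)) (entries (snd p)) i j)"
proof -
  let ?f = "\<lambda>n p :: (real ^ 'n::{finite,linorder}) \<times> (real ^ 'n::{finite,linorder}).
    divdiff_power (entries (fst p)) i n * divdiff_power (entries (snd p)) j n / fact n"
  have bounded: "\<bar>entries x k\<bar> \<le> R" if "norm x < R" for x :: "real ^ 'n::{finite,linorder}" and k R
    unfolding entries_def using component_le_norm_cart[of x "inv position k"] that by linarith
  have ball: "continuous_on (ball 0 R \<times> ball 0 R) (\<lambda>p. \<Sum>n. ?f n p)" for R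
  proof -
    have "norm (?f n p) \<le> ((R + 1) * (R + 1)) ^ n / fact n" if "p \<in> ball 0 R \<times> ball 0 R" for n p
      using that by (intro norm_divdiff_exp2_term_le bounded) (simp_all add: mem_Times_iff)
    then have limit: "uniform_limit (ball 0 R \<times> ball 0 R) (\<lambda>n p. \<Sum>k<n. ?f k p)
        (\<lambda>p. \<Sum>k. ?f k p) sequentially"
      by (rule Weierstrass_m_test[OF _ summable_power_over_fact])
    have continuous: "continuous_on (ball 0 R \<times> ball 0 R) (\<lambda>p. \<Sum>k<n. ?f k p)" for n
    proof -
      have "continuous_on S (\<lambda>p. divdiff_power (entries (fst p)) i k)"
        "continuous_on S (\<lambda>p. divdiff_power (entries (snd p)) j k)"
        for k and S :: "((real ^ 'n::{finite,linorder}) \<times> (real ^ 'n::{finite,linorder})) set"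
        by (rule continuous_on_divdiff_power,
            simp add: entries_def continuous_on_component continuous_on_fst continuous_on_snd)+
      then show ?thesis by (simp add: continuous_on_sum continuous_on_divide continuous_on_mult)
    qed
    show ?thesis
      by (rule uniform_limit_theorem[OF _ limit]) (simp_all add: continuous always_eventually)
  qed
  show ?thesis
    unfolding divdiff_exp2_def
  proof (rule continuous_at_imp_continuous_on, rule ballI)
    fix p :: "(real ^ 'n::{finite,linorder}) \<times> (real ^ 'n::{finite,linorder})"
    define R where "R = norm (fst p) + norm (snd p) + 1"
    have "p \<in> ball 0 R \<times> ball 0 R"
      using norm_ge_zero[of "fst p"] norm_ge_zero[of "snd p"]
      by (simp add: R_def mem_Times_iff del: norm_ge_zero)
    then have "p \<in> interior (ball 0 R \<times> ball 0 R)" by (simp only: interior_open open_Times open_ball)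
    then show "isCont (\<lambda>p. \<Sum>n. ?f n p) p" by (rule continuous_on_interior[OF ball])
  qed
qed

lemma tendsto_hciz:
  assumes "(f \<longlongrightarrow> a) F" "(g \<longlongrightarrow> b) F"
  shows "((\<lambda>x. hciz (f x) (g x)) \<longlongrightarrow> hciz a b) F"
proof -
  have "continuous_on UNIV (\<lambda>p :: (real ^ 'n::{finite,linorder}) \<times> (real ^ 'n::{finite,linorder}). hciz (fst p) (snd p))"
    unfolding hciz_def det_def
    by (simp add: continuous_on_sum continuous_on_mult continuous_on_prod continuous_on_divdiff_exp2)
  from continuous_on_tendsto_compose[OF this tendsto_Pair[OF assms]] show ?thesis by simp
qed


subsection \<open>Transition densities and time inversion\<close>

lemma norm_power2_vec: "(norm (x :: real ^ 'n::finite))\<^sup>2 = (\<Sum>i\<in>UNIV. (x $ i)\<^sup>2)"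
  unfolding power2_norm_eq_inner inner_vec_def by (simp add: power2_eq_square)

lemma prod_exp_sqnorm:
  "(\<Prod>i\<in>UNIV. exp (c * ((x :: real ^ 'n::finite) $ i)\<^sup>2)) = exp (c * (norm x)\<^sup>2)"
  by (simp add: norm_power2_vec sum_distrib_left exp_sum)

text \<open>Expanding the square in the heat kernel leaves Gaussian factors in \<open>y $ j\<close>
  alone and in \<open>x $ k\<close> alone, and a cross term that is a matrix of
  exponentials.\<close>

lemma karlin_mcgregor_eq_hciz:
  fixes x y :: "real ^ 'n::{finite,linorder}"
  assumes "t > 0"
  shows "karlin_mcgregor t y x =
    (1 / sqrt (2 * pi * t)) ^ CARD('n) * exp (- (norm y)\<^sup>2 / (2 * t)) * exp (- (norm x)\<^sup>2 / (2 * t))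
    * (vandermonde (y /\<^sub>R t) * hciz (y /\<^sub>R t) x * vandermonde x)"
proof -
  have "heat_kernel t (y $ j) (x $ k) =
      (1 / sqrt (2 * pi * t) * exp (- 1 / (2 * t) * (y $ j)\<^sup>2)) * exp ((y /\<^sub>R t) $ j * x $ k)
      * exp (- 1 / (2 * t) * (x $ k)\<^sup>2)" for j k
  proof -
    have "- ((y $ j - x $ k)\<^sup>2) / (2 * t) =
      - 1 / (2 * t) * (y $ j)\<^sup>2 + (y /\<^sub>R t) $ j * x $ k + - 1 / (2 * t) * (x $ k)\<^sup>2"
      using assms by (simp add: field_simps power2_eq_square)
    then show ?thesis unfolding heat_kernel_def by (simp only: exp_add mult.assoc)
  qed
  then have "karlin_mcgregor t y x = det (\<chi> j k.
      (1 / sqrt (2 * pi * t) * exp (- 1 / (2 * t) * (y $ j)\<^sup>2))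
      * (\<chi> j k. exp ((y /\<^sub>R t) $ j * x $ k)) $ j $ k * exp (- 1 / (2 * t) * (x $ k)\<^sup>2))"
    by (simp only: karlin_mcgregor_def vec_lambda_beta)
  also have "\<dots> = (1 / sqrt (2 * pi * t)) ^ CARD('n) * exp (- 1 / (2 * t) * (norm y)\<^sup>2)
      * (vandermonde (y /\<^sub>R t) * hciz (y /\<^sub>R t) x * vandermonde x)
      * exp (- 1 / (2 * t) * (norm x)\<^sup>2)"
    unfolding det_scale_rows_columns prod.distrib prod_exp_sqnorm det_exp_eq_hciz by simp
  finally show ?thesis by (simp add: mult_ac)
qed

text \<open>The reversed duration is \<open>(t - s) / (s * t)\<close>. With it the cross terms of
  the two exponents agree, and their difference consists of one term in \<open>a\<close> and one in
  \<open>b\<close>.\<close>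

lemma heat_kernel_time_inversion:
  assumes "0 < s" "s < t"
  shows "heat_kernel (t - s) (t * b) (s * a) =
    1 / sqrt (s * t) * exp (- t / 2 * b\<^sup>2) * heat_kernel (1 / s - 1 / t) a b * exp (s / 2 * a\<^sup>2)"
proof -
  have d: "1 / s - 1 / t = (t - s) / (s * t)" using assms by (simp add: field_simps)
  have exponent: "- ((t * b - s * a)\<^sup>2) / (2 * (t - s)) =
      - t / 2 * b\<^sup>2 + - ((a - b)\<^sup>2) / (2 * ((t - s) / (s * t))) + s / 2 * a\<^sup>2"
    using assms by (simp add: divide_simps) (simp add: algebra_simps power2_eq_square)
  have sq: "sqrt (2 * pi * (t - s)) = sqrt (s * t) * sqrt (2 * pi * ((t - s) / (s * t)))"
    using assms by (simp add: real_sqrt_mult[symmetric])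
  show ?thesis
    unfolding heat_kernel_def d exponent exp_add sq by simp
qed

lemma karlin_mcgregor_time_inversion:
  fixes x y :: "real ^ 'n::{finite,linorder}"
  assumes "0 < s" "s < t"
  shows "karlin_mcgregor (t - s) (t *\<^sub>R y) (s *\<^sub>R x) =
    (1 / sqrt (s * t)) ^ CARD('n) * exp (- t / 2 * (norm y)\<^sup>2) * exp (s / 2 * (norm x)\<^sup>2)
    * karlin_mcgregor (1 / s - 1 / t) x y"
proof -
  \<comment> \<open>Source and target change places under inversion, hence the transpose.\<close>
  have "karlin_mcgregor (t - s) (t *\<^sub>R y) (s *\<^sub>R x) = det (\<chi> j k.
      (1 / sqrt (s * t) * exp (- t / 2 * (y $ j)\<^sup>2))
      * transpose (\<chi> j k. heat_kernel (1 / s - 1 / t) (x $ j) (y $ k)) $ j $ k * exp (s / 2 * (x $ k)\<^sup>2))"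
    unfolding karlin_mcgregor_def
    by (simp add: transpose_def heat_kernel_time_inversion[OF assms])
  then show ?thesis
    unfolding det_scale_rows_columns prod.distrib prod_exp_sqnorm det_transpose karlin_mcgregor_def
    by (simp add: mult_ac)
qed

section \<open>Limits at the boundary of the chamber\<close>

lemma weyl_closed_subset_closure: "weyl_closed \<subseteq> closure (weyl :: (real ^ 'n::{finite,linorder}) set)"
proof
  fix x :: "real ^ 'n::{finite,linorder}"
  assume x: "x \<in> weyl_closed"
  \<comment> \<open>A strictly increasing direction: a small positive multiple of it separates
    coinciding coordinates.\<close>
  define r :: "real ^ 'n::{finite,linorder}" where "r = (\<chi> j. real (position j))"
  have "x + (1 / real (Suc n)) *\<^sub>R r \<in> weyl" for n
    using x by (auto simp: weyl_def weyl_closed_def r_def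
        intro!: add_le_less_mono divide_strict_right_mono)
  moreover have "(\<lambda>n. x + (1 / real (Suc n)) *\<^sub>R r) \<longlonglongrightarrow> x + 0 *\<^sub>R r"
    by (intro tendsto_intros LIMSEQ_Suc[OF lim_1_over_n])
  ultimately show "x \<in> closure weyl"
    unfolding closure_sequential by (intro exI[of _ "\<lambda>n. x + (1 / real (Suc n)) *\<^sub>R r"]) simp
qed

lemma weyl_subset_weyl_closed: "weyl \<subseteq> weyl_closed"
  by (auto simp: weyl_def weyl_closed_def less_imp_le)

text \<open>\<open>tendsto_Lim\<close> identifies a limit only along a nontrivial filter.\<close>

lemma at_within_neq_bot: "x \<in> closure S \<Longrightarrow> x \<notin> S \<Longrightarrow> at x within S \<noteq> bot"
  unfolding closure_def by (auto simp: trivial_limit_within)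

text \<open>The part of the transition densities that depends only on time and target. One
  Vandermonde factor comes from the numerator of the density, the other from factoring the
  Karlin-McGregor determinant.\<close>

definition endpoint_factor :: "real \<Rightarrow> real ^ 'n::{finite,linorder} \<Rightarrow> real" where
  "endpoint_factor t y = (1 / sqrt (2 * pi * t)) ^ CARD('n) * exp (- (norm y)\<^sup>2 / (2 * t))
     * vandermonde y * vandermonde (y /\<^sub>R t)"

text \<open>In the open chamber \<open>vandermonde x\<close> cancels; what remains is continuous in
  \<open>x\<close> and hence equals the boundary limit too.\<close>

lemma driftless_density_eq:
  fixes x :: "real ^ 'n::{finite,linorder}"
  assumes t: "t > 0" and x: "x \<in> weyl_closed"
  shows "driftless_density t y x =
    endpoint_factor t y * exp (- (norm x)\<^sup>2 / (2 * t)) * hciz (y /\<^sub>R t) x"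
proof -
  let ?d = "\<lambda>x. endpoint_factor t y * exp (- (norm x)\<^sup>2 / (2 * t)) * hciz (y /\<^sub>R t) x"
  have interior: "driftless_density_interior t y x = ?d x" if "x \<in> weyl" for x
    unfolding driftless_density_interior_def karlin_mcgregor_eq_hciz[OF t] endpoint_factor_def
    using vandermonde_pos[OF that] by (simp add: field_simps)
  show ?thesis
  proof (cases "x \<in> weyl")
    case False
    have "(?d \<longlongrightarrow> ?d x) (at x within weyl)"
      using t by (intro tendsto_intros tendsto_hciz) auto
    moreover have "\<forall>\<^sub>F x in at x within weyl. ?d x = driftless_density_interior t y x"
      using interior by (auto simp: eventually_at_filter)
    ultimately have "((\<lambda>x. driftless_density_interior t y x) \<longlongrightarrow> ?d x) (at x within weyl)"
      by (rule Lim_transform_eventually)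
    moreover have "at x within weyl \<noteq> bot"
      using x False weyl_closed_subset_closure by (intro at_within_neq_bot) auto
    ultimately show ?thesis using False by (simp add: driftless_density_def tendsto_Lim)
  qed (simp add: driftless_density_def interior)
qed

text \<open>The Vandermonde factors of \<open>x\<close> and \<open>\<nu>\<close> cancel in the
  interior. The hypothesis on \<open>hciz \<nu> x\<close> keeps the quotient continuous at the limit
  point; it holds for \<open>x\<close> in the open chamber and for the origin.\<close>

lemma drift_density_eq:
  fixes x \<nu> :: "real ^ 'n::{finite,linorder}"
  assumes t: "t > 0" and x: "x \<in> weyl_closed" and \<nu>: "\<nu> \<in> weyl_closed"
    and nz: "hciz \<nu> x \<noteq> 0"
  shows "drift_density \<nu> t y x =
    endpoint_factor t y * exp (- t * (norm \<nu>)\<^sup>2 / 2) * exp (- (norm x)\<^sup>2 / (2 * t))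
    * hciz \<nu> y * hciz (y /\<^sub>R t) x / hciz \<nu> x"
proof -
  let ?d = "\<lambda>(x, \<nu>). endpoint_factor t y * exp (- t * (norm \<nu>)\<^sup>2 / 2)
    * exp (- (norm x)\<^sup>2 / (2 * t)) * hciz \<nu> y * hciz (y /\<^sub>R t) x / hciz \<nu> x"
  have interior: "drift_density_interior \<nu> t y x = ?d (x, \<nu>)"
    if "x \<in> weyl" "\<nu> \<in> weyl" for x \<nu> :: "real ^ 'n::{finite,linorder}"
    unfolding drift_density_interior_def karlin_mcgregor_eq_hciz[OF t] endpoint_factor_def det_exp_eq_hciz
    using vandermonde_pos[OF that(1)] vandermonde_pos[OF that(2)] hciz_nonzero[OF that(1), of \<nu>]
    by (simp add: field_simps)
  show ?thesis
  proof (cases "x \<in> weyl \<and> \<nu> \<in> weyl")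
    case False
    have "(?d \<longlongrightarrow> ?d (x, \<nu>)) (at (x, \<nu>) within weyl \<times> weyl)"
    proof -
      have "((\<lambda>p. endpoint_factor t y * exp (- t * (norm (snd p))\<^sup>2 / 2)
          * exp (- (norm (fst p))\<^sup>2 / (2 * t)) * hciz (snd p) y * hciz (y /\<^sub>R t) (fst p) / hciz (snd p) (fst p))
          \<longlongrightarrow> ?d (x, \<nu>)) (at (x, \<nu>) within weyl \<times> weyl)"
        unfolding split using t nz
        by (intro tendsto_intros tendsto_hciz) (auto intro!: tendsto_eq_intros)
      then show ?thesis by (simp add: case_prod_unfold)
    qed
    moreover have "\<forall>\<^sub>F p in at (x, \<nu>) within weyl \<times> weyl.
        ?d p = (\<lambda>(x', \<nu>'). drift_density_interior \<nu>' t y x') p"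
      unfolding eventually_at_filter by (rule always_eventually) (auto simp: interior)
    ultimately have "((\<lambda>(x', \<nu>'). drift_density_interior \<nu>' t y x') \<longlongrightarrow> ?d (x, \<nu>)) (at (x, \<nu>) within weyl \<times> weyl)"
      by (rule Lim_transform_eventually)
    moreover have "at (x, \<nu>) within weyl \<times> weyl \<noteq> bot"
      using x \<nu> False weyl_closed_subset_closure
      by (intro at_within_neq_bot) (auto simp: closure_Times)
    ultimately show ?thesis
      unfolding drift_density_def if_not_P[OF False] by (simp add: tendsto_Lim)
  qed (simp add: drift_density_def interior)
qed

text \<open>The form used for every step after the first: a Doob transform of the Karlin-McGregor
  kernel by \<open>hciz \<nu> x * vandermonde x\<close>, valid for coinciding drifts.\<close>

lemma drift_density_eq_karlin_mcgregor:
  fixes x \<nu> :: "real ^ 'n::{finite,linorder}"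
  assumes t: "t > 0" and x: "x \<in> weyl" and \<nu>: "\<nu> \<in> weyl_closed"
  shows "drift_density \<nu> t y x = exp (- t * (norm \<nu>)\<^sup>2 / 2)
    * (hciz \<nu> y * vandermonde y / (hciz \<nu> x * vandermonde x)) * karlin_mcgregor t y x"
proof -
  have "x \<in> weyl_closed" using x weyl_subset_weyl_closed by auto
  note eq = drift_density_eq[OF t this \<nu> hciz_nonzero[OF x]]
  show ?thesis
    unfolding eq karlin_mcgregor_eq_hciz[OF t]
      endpoint_factor_def
    using vandermonde_pos[OF x] hciz_nonzero[OF x, of \<nu>] by (simp add: field_simps)
qed

section \<open>Common marginals and reversal of the chain\<close>

lemma sqrt_2pi_power:
  assumes "t > 0"
  shows "t ^ n * (1 / sqrt (2 * pi * t)) ^ n = (sqrt t / sqrt (2 * pi)) ^ n"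
proof -
  have "t * (1 / sqrt (2 * pi * t)) = sqrt t / sqrt (2 * pi)"
    using assms by (simp add: real_sqrt_mult field_simps)
  then show ?thesis by (simp only: power_mult_distrib[symmetric])
qed

text \<open>By \<open>hciz_0_left\<close> the factors \<open>hciz\<close> at the origin share one
  nonzero value and cancel. The power of \<open>t\<close> is the Jacobian of the dilatation.\<close>

lemma drift_density_from_0:
  fixes y \<nu> :: "real ^ 'n::{finite,linorder}"
  assumes t: "t > 0" and \<nu>: "\<nu> \<in> weyl_closed"
  shows "t ^ CARD('n) * drift_density \<nu> t (t *\<^sub>R y) 0 = driftless_density (1 / t) y \<nu>"
proof -
  have "(0 :: real ^ 'n::{finite,linorder}) \<in> weyl_closed" by (simp add: weyl_closed_def)
  moreover have z: "hciz a (0 :: real ^ 'n::{finite,linorder}) = hciz 0 (0 :: real ^ 'n::{finite,linorder})" for a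
    by (subst hciz_commute) (simp add: hciz_0_left)
  have "hciz \<nu> 0 \<noteq> 0" using hciz_0_nonzero z[of \<nu>] by simp
  ultimately have "t ^ CARD('n) * drift_density \<nu> t (t *\<^sub>R y) 0 =
     t ^ CARD('n) * endpoint_factor t (t *\<^sub>R y) * exp (- t * (norm \<nu>)\<^sup>2 / 2) * hciz (t *\<^sub>R y) \<nu>"
    using t \<nu> z[of \<nu>] z[of y] hciz_0_nonzero[of "0 :: real ^ 'n::{finite,linorder}"]
    by (simp add: drift_density_eq hciz_commute[of \<nu>])
  also have "t ^ CARD('n) * endpoint_factor t (t *\<^sub>R y) = endpoint_factor (1 / t) y"
  proof -
    have "t ^ CARD('n) * (1 / sqrt (2 * pi * t)) ^ CARD('n) = (1 / sqrt (2 * pi * (1 / t))) ^ CARD('n)"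
      unfolding sqrt_2pi_power[OF t] by (simp add: real_sqrt_divide)
    moreover have "- (norm (t *\<^sub>R y))\<^sup>2 / (2 * t) = - (norm y)\<^sup>2 / (2 * (1 / t))"
      using t by (simp add: power_mult_distrib power2_eq_square)
    \<comment> \<open>The two Vandermonde factors in \<open>endpoint_factor\<close> exchange their
      roles.\<close>
    moreover have "(t *\<^sub>R y) /\<^sub>R t = y" "y /\<^sub>R (1 / t) = t *\<^sub>R y" using t by simp_all
    ultimately show ?thesis
      unfolding endpoint_factor_def by (simp only: mult.assoc[symmetric]) (simp only: mult_ac)
  qed
  also have "endpoint_factor (1 / t) y * exp (- t * (norm \<nu>)\<^sup>2 / 2) * hciz (t *\<^sub>R y) \<nu> =
      driftless_density (1 / t) y \<nu>"
    using t \<nu> by (simp add: driftless_density_eq mult.commute)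
  finally show ?thesis .
qed

text \<open>The marginal at \<open>s\<close> contains the denominator of the Doob transform, and its
  Gaussian in \<open>x\<close> cancels the one produced by time inversion. The remaining factors
  form the marginal at \<open>t\<close> and the reversed driftless step.\<close>

lemma drift_density_detailed_balance:
  fixes x y \<nu> :: "real ^ 'n::{finite,linorder}"
  assumes st: "0 < s" "s < t" and \<nu>: "\<nu> \<in> weyl_closed" and x: "x \<in> weyl" and y: "y \<in> weyl"
  shows "driftless_density (1 / s) x \<nu> * (t ^ CARD('n) * drift_density \<nu> (t - s) (t *\<^sub>R y) (s *\<^sub>R x))
    = driftless_density (1 / t) y \<nu> * driftless_density (1 / s - 1 / t) x y"
proof -
  have t: "t > 0" using st by simp
  have sx: "s *\<^sub>R x \<in> weyl" using x st by (simp add: weyl_def)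
  have power: "(sqrt s / sqrt (2 * pi)) ^ CARD('n) * (t ^ CARD('n) * (1 / sqrt (s * t)) ^ CARD('n))
      = (sqrt t / sqrt (2 * pi)) ^ CARD('n)"
  proof -
    have "sqrt s / sqrt (2 * pi) * (t * (1 / sqrt (s * t))) = sqrt t / sqrt (2 * pi)"
      using st t by (simp add: real_sqrt_mult field_simps)
    then show ?thesis by (simp only: power_mult_distrib[symmetric])
  qed
  have marginal: "driftless_density (1 / r) z \<nu> =
      (sqrt r / sqrt (2 * pi)) ^ CARD('n) * exp (- r / 2 * (norm z)\<^sup>2) * vandermonde z
      * vandermonde (r *\<^sub>R z) * exp (- r / 2 * (norm \<nu>)\<^sup>2) * hciz \<nu> (r *\<^sub>R z)"
    if "r > 0" for r and z :: "real ^ 'n::{finite,linorder}"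
    using that \<nu>
    by (simp add: driftless_density_eq endpoint_factor_def real_sqrt_divide hciz_commute[of \<nu>] mult.commute)
  have expn: "exp (- s / 2 * (norm \<nu>)\<^sup>2) * exp (- (t - s) * (norm \<nu>)\<^sup>2 / 2) = exp (- t / 2 * (norm \<nu>)\<^sup>2)"
    by (simp add: exp_add[symmetric] field_simps)
  have expx: "exp (- s / 2 * (norm x)\<^sup>2) * exp (s / 2 * (norm x)\<^sup>2) = 1"
    by (simp add: exp_add[symmetric])
  let ?q = "karlin_mcgregor (1 / s - 1 / t) x y"
  have km: "driftless_density (1 / s - 1 / t) x y = vandermonde x / vandermonde y * ?q"
    using y by (simp add: driftless_density_def driftless_density_interior_def)
  \<comment> \<open>The product is grouped so that \<open>power\<close>, \<open>expx\<close> and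
    \<open>expn\<close> each rewrite one bracket and the fourth bracket equals 1.\<close>
  have "driftless_density (1 / s) x \<nu> * (t ^ CARD('n) * drift_density \<nu> (t - s) (t *\<^sub>R y) (s *\<^sub>R x)) =
     ((sqrt s / sqrt (2 * pi)) ^ CARD('n) * (t ^ CARD('n) * (1 / sqrt (s * t)) ^ CARD('n)))
     * (exp (- s / 2 * (norm x)\<^sup>2) * exp (s / 2 * (norm x)\<^sup>2))
     * (exp (- s / 2 * (norm \<nu>)\<^sup>2) * exp (- (t - s) * (norm \<nu>)\<^sup>2 / 2))
     * (hciz \<nu> (s *\<^sub>R x) * vandermonde (s *\<^sub>R x) / (hciz \<nu> (s *\<^sub>R x) * vandermonde (s *\<^sub>R x)))
     * (hciz \<nu> (t *\<^sub>R y) * vandermonde (t *\<^sub>R y) * exp (- t / 2 * (norm y)\<^sup>2) * vandermonde x * ?q)"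
    unfolding marginal[OF st(1)] drift_density_eq_karlin_mcgregor[OF diff_gt_0_iff_gt[THEN iffD2, OF st(2)] sx \<nu>]
      karlin_mcgregor_time_inversion[OF st]
    by (simp only: mult_ac divide_inverse inverse_mult_distrib)
  also have "\<dots> = driftless_density (1 / t) y \<nu> * driftless_density (1 / s - 1 / t) x y"
    unfolding power expn expx marginal[OF t] km
    using vandermonde_pos[OF sx] hciz_nonzero[OF sx, of \<nu>] vandermonde_pos[OF y] by simp
  finally show ?thesis .
qed

text \<open>Induction on the number of times: the marginal sits at the last time treated, and
  detailed balance carries it over the next step while reversing that step.\<close>

lemma multitime_density_drift_eq_driftless:
  fixes \<nu> :: "real ^ 'n::{finite,linorder}"
  assumes "admissible_times M t" and \<nu>: "\<nu> \<in> weyl_closed"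
    and "\<And>m. m \<in> {1..M} \<Longrightarrow> ys m \<in> weyl"
  shows "(\<Prod>m\<in>{1..M}. t m ^ CARD('n))
      * multitime_density (drift_density \<nu>) 0 M t (\<lambda>m. t m *\<^sub>R ys m) =
    multitime_density driftless_density \<nu> M (\<lambda>k. 1 / t (M + 1 - k)) (\<lambda>k. ys (M + 1 - k))"
proof -
  let ?c = "\<lambda>m. driftless_density (1 / t m - 1 / t (m + 1)) (ys m) (ys (m + 1))"
  let ?p = "\<lambda>m. drift_density \<nu> (t (m + 1) - t m) (t (m + 1) *\<^sub>R ys (m + 1)) (t m *\<^sub>R ys m)"
  have M: "1 \<le> M" and t1: "0 < t 1" and mono: "strict_mono_on {1..M} t"
    using assms(1) by (auto simp: admissible_times_def)
  have pos: "0 < t m" if "m \<in> {1..M}" for m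
  proof -
    have "t 1 \<le> t m" using strict_mono_on_leD[OF mono, of 1 m] that by auto
    then show ?thesis using t1 by simp
  qed
  have "(\<Prod>m\<in>{1..K}. t m ^ CARD('n)) * (drift_density \<nu> (t 1) (t 1 *\<^sub>R ys 1) 0 * (\<Prod>m\<in>{1..<K}. ?p m)) =
      driftless_density (1 / t K) (ys K) \<nu> * (\<Prod>m\<in>{1..<K}. ?c m)" if "1 \<le> K" "K \<le> M" for K
    using that
  proof (induction K rule: nat_induct_at_least)
    case base
    then show ?case using drift_density_from_0[OF t1 \<nu>, of "ys 1"] by simp
  next
    case (Suc K)
    have lt: "t K < t (K + 1)"
      using strict_mono_onD[OF mono, of K "K + 1"] Suc by auto
    have "(\<Prod>m\<in>{1..Suc K}. t m ^ CARD('n)) *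
        (drift_density \<nu> (t 1) (t 1 *\<^sub>R ys 1) 0 * (\<Prod>m\<in>{1..<Suc K}. ?p m)) =
      ((\<Prod>m\<in>{1..K}. t m ^ CARD('n)) * (drift_density \<nu> (t 1) (t 1 *\<^sub>R ys 1) 0 * (\<Prod>m\<in>{1..<K}. ?p m)))
        * (t (K + 1) ^ CARD('n) * ?p K)"
      using Suc.hyps by (simp add: prod.atLeastLessThan_Suc mult_ac)
    also have "\<dots> = driftless_density (1 / t K) (ys K) \<nu> * (t (K + 1) ^ CARD('n) * ?p K) * (\<Prod>m\<in>{1..<K}. ?c m)"
      using Suc by (simp add: mult_ac)
    also have "driftless_density (1 / t K) (ys K) \<nu> * (t (K + 1) ^ CARD('n) * ?p K) =
        driftless_density (1 / t (K + 1)) (ys (K + 1)) \<nu> * ?c K"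
      using Suc.hyps Suc.prems assms(3) pos[of K]
      by (intro drift_density_detailed_balance \<nu> lt) auto
    also have "\<dots> * (\<Prod>m\<in>{1..<K}. ?c m) =
        driftless_density (1 / t (Suc K)) (ys (Suc K)) \<nu> * (\<Prod>m\<in>{1..<Suc K}. ?c m)"
      using Suc.hyps by (simp add: prod.atLeastLessThan_Suc mult_ac)
    finally show ?case .
  qed
  from this[OF M order_refl]
  have "(\<Prod>m\<in>{1..M}. t m ^ CARD('n))
      * multitime_density (drift_density \<nu>) 0 M t (\<lambda>m. t m *\<^sub>R ys m) =
      driftless_density (1 / t M) (ys M) \<nu> * (\<Prod>m\<in>{1..<M}. ?c m)"
    by (simp add: multitime_density_def)
  \<comment> \<open>Points are reversed by \<open>M + 1 - k\<close>, but the \<open>M - 1\<close>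
    steps between them by \<open>M - k\<close>.\<close>
  also have "(\<Prod>m\<in>{1..<M}. ?c m) =
      (\<Prod>k\<in>{1..<M}. driftless_density (1 / t (M + 1 - (k + 1)) - 1 / t (M + 1 - k))
         (ys (M + 1 - (k + 1))) (ys (M + 1 - k)))"
    by (rule prod.reindex_bij_witness[where i="\<lambda>k. M - k" and j="\<lambda>k. M - k"])
       (auto simp: Suc_diff_le)
  finally show ?thesis using M by (simp add: multitime_density_def)
qed


subsection \<open>Labelings\<close>

lemma configuration_eq_mset:
  "configuration x = mset (map (entries x) [0..<CARD('n)])"
  for x :: "real ^ 'n::{finite,linorder}"
proof -
  have "configuration x = image_mset (entries x) (image_mset position (mset_set (UNIV :: 'n set)))"
    by (simp add: configuration_def multiset.map_comp comp_def)
  also have "image_mset position (mset_set (UNIV :: 'n set)) = mset_set {..<CARD('n)}"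
    using bij_betw_position[where 'n='n] by (simp add: image_mset_mset_set bij_betw_def)
  finally show ?thesis by (simp add: lessThan_atLeast0)
qed

lemma sorted_entries:
  assumes "x \<in> (weyl_closed :: (real ^ 'n::{finite,linorder}) set)"
  shows "sorted (map (entries x) [0..<CARD('n)])"
  unfolding sorted_iff_nth_mono_less
proof (intro allI impI)
  fix i j
  assume ij: "i < j" "j < length (map (entries x) [0..<CARD('n)])"
  then obtain i' j' :: 'n where "i = position i'" "j = position j'"
    using ex_position[where 'n='n, of i] ex_position[where 'n='n, of j] by auto
  then show "map (entries x) [0..<CARD('n)] ! i \<le> map (entries x) [0..<CARD('n)] ! j"
    using ij assms by (auto simp: weyl_closed_def position_less_CARD)
qed

text \<open>Resolves the definite description: a point of the closed chamber is a sorted list, and a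
  multiset has exactly one.\<close>

lemma labeling_eq:
  assumes "size \<xi> = CARD('n)"
  shows "labeling \<xi> = ((\<chi> j. sorted_list_of_multiset \<xi> ! position j) :: real ^ 'n::{finite,linorder})"
    (is "_ = ?x")
  unfolding labeling_def
proof (rule the_equality)
  have len: "length (sorted_list_of_multiset \<xi>) = CARD('n)"
    using assms by (metis mset_sorted_list_of_multiset size_mset)
  have "entries ?x i = sorted_list_of_multiset \<xi> ! i" if i: "i < CARD('n)" for i
  proof -
    obtain j :: 'n where "i = position j" using ex_position[where 'n='n, OF i] by auto
    then show ?thesis by simp
  qed
  then have "map (entries ?x) [0..<CARD('n)] = sorted_list_of_multiset \<xi>"
    by (intro nth_equalityI) (auto simp: len)
  then have "configuration ?x = \<xi>"
    by (simp only: configuration_eq_mset mset_sorted_list_of_multiset)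
  moreover have "?x \<in> weyl_closed"
    using sorted_sorted_list_of_multiset[of \<xi>]
    by (auto simp: weyl_closed_def sorted_iff_nth_mono_less len position_less_CARD)
  ultimately show "?x \<in> weyl_closed \<and> configuration ?x = \<xi>" by simp
next
  fix x :: "real ^ 'n::{finite,linorder}"
  assume x: "x \<in> weyl_closed \<and> configuration x = \<xi>"
  then have \<xi>: "\<xi> = mset (map (entries x) [0..<CARD('n)])"
    by (simp only: configuration_eq_mset)
  have "sorted_list_of_multiset \<xi> = map (entries x) [0..<CARD('n)]"
    unfolding \<xi> sorted_list_of_multiset_mset using x sorted_entries[of x] by (simp only: sorted_sort_id)
  then show "x = ?x" by (simp add: vec_eq_iff position_less_CARD)
qed

lemma sorted_list_of_multiset_image_mono:
  assumes "mono f"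
  shows "sorted_list_of_multiset (image_mset f \<xi>) = map f (sorted_list_of_multiset \<xi>)"
proof -
  have "image_mset f \<xi> = mset (map f (sorted_list_of_multiset \<xi>))" by simp
  moreover have "sorted (map f (sorted_list_of_multiset \<xi>))"
    using assms by (auto simp: sorted_map monoD intro!: sorted_wrt_mono_rel[OF _ sorted_sorted_list_of_multiset])
  ultimately show ?thesis
    by (simp only: sorted_list_of_multiset_mset sorted_sort_id)
qed

text \<open>Multiplication by a positive constant is monotone and so commutes with sorting.\<close>

lemma labeling_dilatation:
  assumes "size \<xi> = CARD('n)" and "c > 0"
  shows "labeling (dilatation c \<xi>) = c *\<^sub>R (labeling \<xi> :: real ^ 'n::{finite,linorder})"
proof -
  have "mono ((*) c)" using assms(2) by (auto simp: mono_def)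
  moreover have "length (sorted_list_of_multiset \<xi>) = CARD('n)"
    using assms(1) by (metis mset_sorted_list_of_multiset size_mset)
  ultimately show ?thesis
    using assms(1)
    by (simp add: labeling_eq dilatation_def sorted_list_of_multiset_image_mono vec_eq_iff
        position_less_CARD)
qed

subsection \<open>Densities under scaling and time reversal\<close>

text \<open>Change of variables for a map whose inverse \<open>S\<close> has constant Jacobian
  \<open>J\<close>; it covers both the dilatation and the reversal of times.\<close>

lemma distributed_bijection:
  assumes Z: "distributed P L Z f"
    and T: "T \<in> measurable L L" and S: "S \<in> measurable L L"
    and inv: "\<And>x. x \<in> space L \<Longrightarrow> S (T x) = x"
    and distr: "distr L L T = density L (\<lambda>_. J)"
    and W: "\<And>\<omega>. \<omega> \<in> space P \<Longrightarrow> W \<omega> = T (Z \<omega>)"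
    and g: "\<And>y. y \<in> space L \<Longrightarrow> g y = J * f (S y)"
  shows "distributed P L W g"
proof -
  have f: "f \<in> borel_measurable L" and ZP: "Z \<in> measurable P L"
    and dZ: "distr P L Z = density L f"
    using Z by (auto simp: distributed_def)
  have fS: "(\<lambda>y. f (S y)) \<in> borel_measurable L" using S f by (rule measurable_compose)
  have gm: "g \<in> borel_measurable L"
    using fS by (subst measurable_cong[OF g]) auto
  have Wm: "W \<in> measurable P L"
    using measurable_compose[OF ZP T] by (subst measurable_cong[OF W]) auto
  have "distr P L W = distr P L (\<lambda>\<omega>. T (Z \<omega>))" by (intro distr_cong W refl)
  also have "\<dots> = distr (density L f) L T"
    using distr_distr[OF T ZP] by (simp add: comp_def dZ)
  \<comment> \<open>Written as a function of \<open>T x\<close>, the density can be pushed forward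
    along \<open>T\<close>.\<close>
  also have "density L f = density L (\<lambda>x. f (S (T x)))"
    using f measurable_compose[OF T fS] inv by (intro density_cong) auto
  also have "distr \<dots> L T = density (distr L L T) (\<lambda>y. f (S y))"
    using fS T by (intro density_distr[symmetric])
  also have "\<dots> = density L (\<lambda>y. J * f (S y))"
    unfolding distr using fS by (intro density_density_eq) auto
  also have "\<dots> = density L g"
    using fS gm g by (intro density_cong) auto
  finally show ?thesis using gm Wm by (simp add: distributed_def)
qed

section \<open>Lebesgue measure on the product over the times\<close>

interpretation lborel_product: product_sigma_finite "\<lambda>_. lborel" ..

lemma measurable_scale_PiM [measurable]:
  "(\<lambda>xs. \<lambda>m\<in>I. c m *\<^sub>R xs m) \<in>
     measurable (PiM I (\<lambda>_. lborel :: 'a::euclidean_space measure)) (PiM I (\<lambda>_. lborel))"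
  by (intro measurable_restrict) measurable

lemma distr_scale_PiM_lborel:
  fixes I :: "'i set"
  assumes I: "finite I" and c: "\<And>m. m \<in> I \<Longrightarrow> c m > 0"
  defines "L \<equiv> PiM I (\<lambda>_. lborel :: 'a::euclidean_space measure)"
  shows "distr L L (\<lambda>xs. \<lambda>m\<in>I. (1 / c m) *\<^sub>R xs m) = density L (\<lambda>_. ennreal (\<Prod>m\<in>I. c m ^ DIM('a)))"
proof -
  define T :: "('i \<Rightarrow> 'a) \<Rightarrow> 'i \<Rightarrow> 'a" where "T = (\<lambda>xs. \<lambda>m\<in>I. (1 / c m) *\<^sub>R xs m)"
  \<comment> \<open>The reciprocal Jacobian: weighted by \<open>k\<close>, the image measure becomes
    the product measure, which is recognised on boxes; the weight is undone afterwards.\<close>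
  define k where "k = (\<Prod>m\<in>I. (1 / c m) ^ DIM('a))"
  have T: "T \<in> measurable L L" unfolding T_def L_def by measurable
  have "density (distr L L T) (\<lambda>_. ennreal k) = PiM I (\<lambda>_. lborel)"
  proof (rule lborel_product.PiM_eqI[OF I])
    fix A :: "'i \<Rightarrow> 'a set"
    assume A: "\<And>i. i \<in> I \<Longrightarrow> A i \<in> sets lborel"
    define B where "B = (\<lambda>m. (\<lambda>x. (1 / c m) *\<^sub>R x) -` A m)"
    have B: "B m \<in> sets lborel" if "m \<in> I" for m
      using measurable_sets[of "\<lambda>x. (1 / c m) *\<^sub>R x" lborel lborel "A m"] A[OF that] by (simp add: B_def)
    have box: "Pi\<^sub>E I A \<in> sets L" unfolding L_def using A I by (intro sets_PiM_I_finite)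
    have "T -` Pi\<^sub>E I A \<inter> space L = Pi\<^sub>E I B"
      by (auto simp: T_def L_def B_def space_PiM PiE_iff extensional_def)
    then have "emeasure (density (distr L L T) (\<lambda>_. ennreal k)) (Pi\<^sub>E I A) = k * emeasure L (Pi\<^sub>E I B)"
      using box T by (simp add: emeasure_density_const emeasure_distr)
    also have "emeasure L (Pi\<^sub>E I B) = (\<Prod>m\<in>I. emeasure lborel (B m))"
      unfolding L_def using I B by (intro lborel_product.emeasure_PiM) auto
    also have "ennreal k * (\<Prod>m\<in>I. emeasure lborel (B m)) =
        (\<Prod>m\<in>I. ennreal ((1 / c m) ^ DIM('a)) * emeasure lborel (B m))"
      unfolding k_def using c by (subst prod_ennreal[symmetric]) (simp_all add: less_imp_le prod.distrib)
    also have "\<dots> = (\<Prod>m\<in>I. emeasure lborel (A m))"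
    proof (rule prod.cong[OF refl])
      fix m assume m: "m \<in> I"
      have "emeasure lborel (A m) =
          emeasure (density (distr lborel borel (\<lambda>x. 0 + (1 / c m) *\<^sub>R x)) (\<lambda>_. ennreal (\<bar>1 / c m\<bar> ^ DIM('a)))) (A m)"
        using c[OF m] by (subst lborel_affine[of "1 / c m" "0 :: 'a"]) auto
      also have "\<dots> = ennreal ((1 / c m) ^ DIM('a)) * emeasure lborel (B m)"
        using A[OF m] c[OF m] by (simp add: emeasure_density_const emeasure_distr B_def)
      finally show "ennreal ((1 / c m) ^ DIM('a)) * emeasure lborel (B m) = emeasure lborel (A m)" ..
    qed
    finally show "emeasure (density (distr L L T) (\<lambda>_. ennreal k)) (Pi\<^sub>E I A) = (\<Prod>i\<in>I. emeasure lborel (A i))" .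
  qed (simp add: L_def)
  then have eq: "density (distr L L T) (\<lambda>_. ennreal k) = L" by (simp add: L_def)
  have "density L (\<lambda>_. ennreal (\<Prod>m\<in>I. c m ^ DIM('a))) =
      density (density (distr L L T) (\<lambda>_. ennreal k)) (\<lambda>_. ennreal (\<Prod>m\<in>I. c m ^ DIM('a)))"
    by (simp only: eq)
  also have "\<dots> = density (distr L L T) (\<lambda>_. ennreal k * ennreal (\<Prod>m\<in>I. c m ^ DIM('a)))"
    by (rule density_density_eq) auto
  also have "ennreal k * ennreal (\<Prod>m\<in>I. c m ^ DIM('a)) = 1"
  proof -
    have "k * (\<Prod>m\<in>I. c m ^ DIM('a)) = 1"
      unfolding k_def prod.distrib[symmetric]
    proof (intro prod.neutral ballI)
      fix m assume "m \<in> I"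
      then have "c m \<noteq> 0" using c[of m] by simp
      then show "(1 / c m) ^ DIM('a) * c m ^ DIM('a) = 1" by (simp add: power_mult_distrib[symmetric])
    qed
    moreover have "0 \<le> k" unfolding k_def using c by (intro prod_nonneg) (simp add: less_imp_le)
    ultimately show ?thesis by (simp add: ennreal_mult'[symmetric])
  qed
  finally show ?thesis by (simp only: density_1 T_def)
qed

lemma measurable_reindex_PiM [measurable]:
  assumes "\<sigma> ` I \<subseteq> I"
  shows "(\<lambda>xs. \<lambda>m\<in>I. xs (\<sigma> m)) \<in>
     measurable (PiM I (\<lambda>_. N)) (PiM I (\<lambda>_. N))"
  using assms by (intro measurable_restrict measurable_component_singleton) auto

text \<open>An involution of the indices maps boxes to boxes with the same sides in another order,
  and boxes determine the product measure.\<close>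

lemma distr_reindex_PiM_lborel:
  fixes I :: "'i set"
  assumes I: "finite I" and \<sigma>: "\<And>m. m \<in> I \<Longrightarrow> \<sigma> m \<in> I" "\<And>m. m \<in> I \<Longrightarrow> \<sigma> (\<sigma> m) = m"
  defines "L \<equiv> PiM I (\<lambda>_. lborel :: 'a::euclidean_space measure)"
  shows "distr L L (\<lambda>xs. \<lambda>m\<in>I. xs (\<sigma> m)) = L"
proof -
  have T: "(\<lambda>xs. \<lambda>m\<in>I. xs (\<sigma> m)) \<in> measurable L L"
    unfolding L_def using \<sigma> by (intro measurable_reindex_PiM) auto
  have "distr L L (\<lambda>xs. \<lambda>m\<in>I. xs (\<sigma> m)) = PiM I (\<lambda>_. lborel)"
  proof (rule lborel_product.PiM_eqI[OF I])
    fix A :: "'i \<Rightarrow> 'a set"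
    assume A: "\<And>i. i \<in> I \<Longrightarrow> A i \<in> sets lborel"
    have box: "Pi\<^sub>E I A \<in> sets L" unfolding L_def using A I by (intro sets_PiM_I_finite)
    have "(\<lambda>xs. \<lambda>m\<in>I. xs (\<sigma> m)) -` Pi\<^sub>E I A \<inter> space L = (\<Pi>\<^sub>E m\<in>I. A (\<sigma> m))"
    proof (intro set_eqI iffI)
      fix xs assume "xs \<in> (\<lambda>xs. \<lambda>m\<in>I. xs (\<sigma> m)) -` Pi\<^sub>E I A \<inter> space L"
      then have "\<forall>m\<in>I. xs (\<sigma> m) \<in> A m" "xs \<in> extensional I"
        by (auto simp: L_def space_PiM PiE_iff)
      moreover have "xs m \<in> A (\<sigma> m)" if "m \<in> I" for m
        using \<open>\<forall>m\<in>I. xs (\<sigma> m) \<in> A m\<close> \<sigma>(1)[OF that] \<sigma>(2)[OF that] by force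
      ultimately show "xs \<in> (\<Pi>\<^sub>E m\<in>I. A (\<sigma> m))" by (simp add: PiE_iff)
    next
      fix xs assume "xs \<in> (\<Pi>\<^sub>E m\<in>I. A (\<sigma> m))"
      then have "\<forall>m\<in>I. xs m \<in> A (\<sigma> m)" "xs \<in> extensional I" by (auto simp: PiE_iff)
      moreover have "xs (\<sigma> m) \<in> A m" if "m \<in> I" for m
        using \<open>\<forall>m\<in>I. xs m \<in> A (\<sigma> m)\<close> \<sigma>(1)[OF that] \<sigma>(2)[OF that] by force
      ultimately show "xs \<in> (\<lambda>xs. \<lambda>m\<in>I. xs (\<sigma> m)) -` Pi\<^sub>E I A \<inter> space L"
        by (auto simp: L_def space_PiM PiE_iff)
    qed
    then have "emeasure (distr L L (\<lambda>xs. \<lambda>m\<in>I. xs (\<sigma> m))) (Pi\<^sub>E I A) = (\<Prod>m\<in>I. emeasure lborel (A (\<sigma> m)))"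
      using box T \<sigma> A I by (simp add: emeasure_distr) (simp add: L_def lborel_product.emeasure_PiM)
    also have "\<dots> = (\<Prod>m\<in>I. emeasure lborel (A m))"
      using \<sigma> by (intro prod.reindex_bij_witness[where i=\<sigma> and j=\<sigma>]) auto
    finally show "emeasure (distr L L (\<lambda>xs. \<lambda>m\<in>I. xs (\<sigma> m))) (Pi\<^sub>E I A) = (\<Prod>i\<in>I. emeasure lborel (A i))" .
  qed (simp add: L_def)
  then show ?thesis by (simp add: L_def)
qed


text \<open>Reconciles plain functions of the index with their restrictions to the product space,
  which are undefined outside \<open>{1..M}\<close>.\<close>

lemma multitime_density_cong:
  assumes "1 \<le> M" and "\<And>m. m \<in> {1..M} \<Longrightarrow> xs m = ys m"
  shows "multitime_density p x M t xs = multitime_density p x M t ys"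
  using assms by (auto simp: multitime_density_def intro!: prod.cong arg_cong2[where f="(*)"])

theorem theorem2p1:
  fixes \<nu> :: "real ^ 'n::{finite,linorder}"
    and P :: "'v measure" and X :: "real \<Rightarrow> 'v \<Rightarrow> real multiset"
    and Q :: "'w measure" and Y :: "real \<Rightarrow> 'w \<Rightarrow> real multiset"
  assumes "\<nu> \<in> weyl_closed"
    and "noncolliding_BM_drift \<nu> 0 P X"
    and "noncolliding_BM \<nu> Q Y"
  shows "equal_in_law TYPE('n)
           P (\<lambda>t \<omega>. dilatation (1 / t) (X t \<omega>))
           Q (\<lambda>t \<omega>. Y (1 / t) \<omega>)"
  unfolding equal_in_law_def
proof (intro allI impI)
  fix M :: nat and t :: "nat \<Rightarrow> real"
  assume t: "admissible_times M t"
  \<comment> \<open>Reciprocals reverse the order, so listing them backwards gives increasing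
    times.\<close>
  define s where "s = (\<lambda>k. 1 / t (M + 1 - k))"
  define I where "I = {1..M}"
  define L where "L = PiM I (\<lambda>_. lborel :: (real ^ 'n::{finite,linorder}) measure)"
  \<comment> \<open>The common density: that of the driftless process at the times \<open>s\<close>,
    with its arguments listed backwards.\<close>
  define \<rho> :: "(nat \<Rightarrow> real ^ 'n::{finite,linorder}) \<Rightarrow> real" where
    "\<rho> = (\<lambda>ys. multitime_density driftless_density \<nu> M s (\<lambda>k. ys (M + 1 - k)))"
  let ?W = "Pi\<^sub>E I (\<lambda>_. weyl :: (real ^ 'n::{finite,linorder}) set)"
  have M: "1 \<le> M" and t1: "0 < t 1" and mono: "strict_mono_on I t"
    using t by (auto simp: admissible_times_def I_def)
  have pos: "0 < t m" if "m \<in> I" for m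
  proof -
    have "t 1 \<le> t m" using strict_mono_on_leD[OF mono, of 1 m] that by (auto simp: I_def)
    then show ?thesis using t1 by simp
  qed
  have s: "admissible_times M s"
    unfolding admissible_times_def
  proof (intro conjI M)
    show "0 < s 1" using pos[of M] M by (simp add: s_def I_def)
    show "strict_mono_on {1..M} s"
    proof (rule strict_mono_onI)
      fix i j assume ij: "i \<in> {1..M}" "j \<in> {1..M}" "i < j"
      then have "t (M + 1 - j) < t (M + 1 - i)"
        by (intro strict_mono_onD[OF mono]) (auto simp: I_def)
      moreover have "0 < t (M + 1 - j)" using ij by (intro pos) (auto simp: I_def)
      ultimately show "s i < s j" by (simp add: s_def frac_less2)
    qed
  qed
  have X: "\<forall>m\<in>I. \<forall>\<omega>\<in>space P. size (X (t m) \<omega>) = CARD('n)"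
    and X_distr: "distributed P L (\<lambda>\<omega>. \<lambda>m\<in>I. labeling (X (t m) \<omega>))
      (\<lambda>xs. ennreal (multitime_density (drift_density \<nu>) 0 M t xs) * indicator ?W xs)"
    using assms(2) t
    unfolding noncolliding_BM_drift_def process_with_density_def has_joint_density_def I_def L_def by auto
  have Y: "\<forall>m\<in>I. \<forall>\<omega>\<in>space Q. size (Y (s m) \<omega>) = CARD('n)"
    and Y_distr: "distributed Q L (\<lambda>\<omega>. \<lambda>m\<in>I. labeling (Y (s m) \<omega>))
      (\<lambda>xs. ennreal (multitime_density driftless_density \<nu> M s xs) * indicator ?W xs)"
    using assms(3) s
    unfolding noncolliding_BM_def process_with_density_def has_joint_density_def I_def L_def by auto

  have P_side: "has_joint_density P (\<lambda>t \<omega>. dilatation (1 / t) (X t \<omega>)) M t \<rho>"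
    unfolding has_joint_density_def I_def[symmetric] L_def[symmetric]
  proof (intro conjI)
    show "\<forall>m\<in>I. \<forall>\<omega>\<in>space P. size (dilatation (1 / t m) (X (t m) \<omega>)) = CARD('n)"
      using X by (simp add: dilatation_def)
    show "distributed P L (\<lambda>\<omega>. \<lambda>m\<in>I. labeling (dilatation (1 / t m) (X (t m) \<omega>)))
       (\<lambda>xs. ennreal (\<rho> xs) * indicator ?W xs)"
    proof (rule distributed_bijection[OF X_distr])
      let ?T = "\<lambda>xs. \<lambda>m\<in>I. (1 / t m) *\<^sub>R xs m :: real ^ 'n::{finite,linorder}"
      let ?S = "\<lambda>xs. \<lambda>m\<in>I. t m *\<^sub>R xs m :: real ^ 'n::{finite,linorder}"
      show "?T \<in> measurable L L" "?S \<in> measurable L L"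
        unfolding L_def by (rule measurable_scale_PiM)+
      show "?S (?T xs) = xs" if "xs \<in> space L" for xs
        using that pos by (auto simp: L_def space_PiM PiE_iff extensional_def fun_eq_iff less_imp_neq[symmetric])
      show "distr L L ?T = density L (\<lambda>_. ennreal (\<Prod>m\<in>I. t m ^ CARD('n)))"
        using distr_scale_PiM_lborel[of I t, where 'a="real ^ 'n::{finite,linorder}"] pos by (simp add: L_def I_def)
      show "(\<lambda>m\<in>I. labeling (dilatation (1 / t m) (X (t m) \<omega>))) = ?T (\<lambda>m\<in>I. labeling (X (t m) \<omega>))"
        if "\<omega> \<in> space P" for \<omega>
        using X pos that by (intro restrict_ext) (simp add: labeling_dilatation)
      show "ennreal (\<rho> ys) * indicator ?W ys = ennreal (\<Prod>m\<in>I. t m ^ CARD('n))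
          * (ennreal (multitime_density (drift_density \<nu>) 0 M t (?S ys)) * indicator ?W (?S ys))"
        if ys: "ys \<in> space L" for ys
      proof -
        \<comment> \<open>Positive scaling preserves the open chamber, so both indicators
          agree.\<close>
        have W: "?S ys \<in> ?W \<longleftrightarrow> ys \<in> ?W"
          using ys pos by (auto simp: L_def space_PiM PiE_iff weyl_def)
        show ?thesis
        proof (cases "ys \<in> ?W")
          case True
          have "\<rho> ys = (\<Prod>m\<in>I. t m ^ CARD('n))
              * multitime_density (drift_density \<nu>) 0 M t (\<lambda>m. t m *\<^sub>R ys m)"
            unfolding \<rho>_def s_def I_def using True
            by (intro multitime_density_drift_eq_driftless[OF t assms(1), symmetric]) (auto simp: I_def)
          also have "multitime_density (drift_density \<nu>) 0 M t (\<lambda>m. t m *\<^sub>R ys m) =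
              multitime_density (drift_density \<nu>) 0 M t (?S ys)"
            by (rule multitime_density_cong[OF M]) (simp add: I_def)
          finally show ?thesis
            using True W pos by (simp add: ennreal_mult' prod_nonneg less_imp_le)
        next
          case False
          with W show ?thesis by (simp add: indicator_def)
        qed
      qed
    qed
  qed

  have Q_side: "has_joint_density Q (\<lambda>t \<omega>. Y (1 / t) \<omega>) M t \<rho>"
    unfolding has_joint_density_def I_def[symmetric] L_def[symmetric]
  proof (intro conjI)
    have flip: "M + 1 - m \<in> I" "s (M + 1 - m) = 1 / t m" if "m \<in> I" for m
      using that by (auto simp: I_def s_def)
    show "\<forall>m\<in>I. \<forall>\<omega>\<in>space Q. size (Y (1 / t m) \<omega>) = CARD('n)"
      using Y flip by metis
    let ?T = "\<lambda>xs. \<lambda>m\<in>I. xs (M + 1 - m) :: real ^ 'n::{finite,linorder}"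
    show "distributed Q L (\<lambda>\<omega>. \<lambda>m\<in>I. labeling (Y (1 / t m) \<omega>))
       (\<lambda>xs. ennreal (\<rho> xs) * indicator ?W xs)"
    \<comment> \<open>Reversal is its own inverse and preserves Lebesgue measure, so
      \<open>?T\<close> plays both parts and the Jacobian is 1.\<close>
    proof (rule distributed_bijection[OF Y_distr])
      show "?T \<in> measurable L L" "?T \<in> measurable L L"
        unfolding L_def using flip by (intro measurable_reindex_PiM; auto)+
      show "?T (?T xs) = xs" if "xs \<in> space L" for xs
        using that flip by (auto simp: L_def I_def space_PiM PiE_iff extensional_def fun_eq_iff)
      show "distr L L ?T = density L (\<lambda>_. 1)"
        unfolding density_1 L_def by (rule distr_reindex_PiM_lborel) (auto simp: I_def)
      show "(\<lambda>m\<in>I. labeling (Y (1 / t m) \<omega>)) = ?T (\<lambda>m\<in>I. labeling (Y (s m) \<omega>))" for \<omega>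
        using flip by (intro restrict_ext) simp
      show "ennreal (\<rho> ys) * indicator ?W ys =
          1 * (ennreal (multitime_density driftless_density \<nu> M s (?T ys)) * indicator ?W (?T ys))"
        if ys: "ys \<in> space L" for ys
      proof -
        have "?T ys \<in> ?W \<longleftrightarrow> (\<forall>m\<in>I. ys (M + 1 - m) \<in> weyl)" by (auto simp: PiE_iff)
        also have "\<dots> \<longleftrightarrow> (\<forall>m\<in>I. ys m \<in> weyl)"
        proof safe
          fix m assume *: "\<forall>m\<in>I. ys (M + 1 - m) \<in> weyl" and m: "m \<in> I"
          then have "ys (M + 1 - (M + 1 - m)) \<in> weyl" using flip(1) by blast
          then show "ys m \<in> weyl" using m by (simp add: I_def)
        qed (use flip(1) in blast)
        also have "\<dots> \<longleftrightarrow> ys \<in> ?W" using ys by (auto simp: L_def space_PiM PiE_iff)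
        finally have W: "?T ys \<in> ?W \<longleftrightarrow> ys \<in> ?W" .
        have "\<rho> ys = multitime_density driftless_density \<nu> M s (?T ys)"
          unfolding \<rho>_def by (rule multitime_density_cong[OF M]) (simp add: I_def)
        then show ?thesis using W by (simp add: indicator_def)
      qed
    qed
  qed

  show "\<exists>\<rho> :: (nat \<Rightarrow> real ^ 'n::{finite,linorder}) \<Rightarrow> real.
      has_joint_density P (\<lambda>t \<omega>. dilatation (1 / t) (X t \<omega>)) M t \<rho> \<and>
      has_joint_density Q (\<lambda>t \<omega>. Y (1 / t) \<omega>) M t \<rho>"
    using P_side Q_side by blast
qed

end
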